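(* Let $p$ be a prime, let $A$ be a commutative ring with $\mathbb{Q}\subseteq A$ and let $|_0$ be a $p$-archimedean $p$-divisibility on $A$. Let $X=\mathrm{Spec}^{\max}D_p(A,|_0)$. Then for every $a\in A$ the map $\widehat a:X\to\mathbb{Q}_p$ is continuous. Therefore $\phi:A\to C(X,\mathbb{Q}_p)$, $\phi(a)=\widehat a$, is a ring homomorphism whose image $\phi(A)$ is dense in $C(X,\mathbb{Q}_p)$ (with respect to the maximum norm $\|f\|^*=\max_{x\in X}|f(x)|_p$), and for all $a,b\in A$: $a|_0b\Rightarrow \phi(a)|^*\phi(b)$.
   Context: A divisibility on $A$ is a binary relation $|\subseteq A\times A$ such that for all $a,b,c$: (1) $a|a$; (2) $a|b,\ b|c\Rightarrow a|c$; (3) $a|b,\ a|c\Rightarrow a|b-c$; (4) $a|b\Rightarrow ac|bc$; (5) $0\nmid1$. A $p$-divisibility additionally satisfies for all $a,b$: (6) $0\nmid a\Rightarrow pa\nmid a$; (7) $p[(a^pb-b^pa)^2-(b^{p+1})^2]\ \big|\ (a^pb-b^pa)b^{p+1}$. It is $p$-archimedean if for all $a$ there is $m\in\mathbb{Z}$ with $p^m|a$. Support $I(|)=\{a;\ 0|a\}$. $\mathrm{Spec}\,D_p(A,|_0)$ is the set of $p$-divisibilities containing $|_0$ that are total ($a|b$ or $b|a$) and have cancellation ($0\nmid c,\ ac|bc\Rightarrow a|b$); $\mathrm{Spec}^{\max}$ denotes its maximal elements under inclusion. $X$ carries the topology generated by $U(a,b)=\{|\in X;\ a\nmid b\}$.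 For $|\in X$, $I(|)$ is prime and $|$ is induced by a valuation $\bar v$ on $F=\mathrm{Quot}(A/I(|))$ with value group $\mathbb{Z}$, $\bar v(p)=1$, residue field $\mathbb{F}_p$, via $a|b\Leftrightarrow\bar v(a+I(|))\le\bar v(b+I(|))$; the completion of $(F,\bar v)$ is uniquely identified with $\mathbb{Q}_p$, and $\alpha_|:A\to A/I(|)\subseteq F\hookrightarrow\mathbb{Q}_p$ is the resulting homomorphism. Then $\widehat a(|):=\alpha_|(a)$. $|^*$ is the canonical $p$-adic divisibility on $C(X,\mathbb{Q}_p)$: $f|^*g\Leftrightarrow v_p(f(x))\le v_p(g(x))$ for all $x\in X$; $|x|_p=p^{-v_p(x)}$. *)

theory Defs
  imports "HOL-Analysis.Analysis" "HOL-Computational_Algebra.Primes"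
begin

definition padic_val_rat :: "nat \<Rightarrow> rat \<Rightarrow> int" where
  "padic_val_rat p q =
     int (multiplicity (int p) (fst (quotient_of q))) - int (multiplicity (int p) (snd (quotient_of q)))"

text \<open>x and y agree up to valuation n (v(0) is read as +infinity).\<close>
definition vclose :: "('k::field \<Rightarrow> int) \<Rightarrow> int \<Rightarrow> 'k \<Rightarrow> 'k \<Rightarrow> bool" where
  "vclose v n x y \<longleftrightarrow> x = y \<or> n \<le> v (x - y)"

text \<open>(K, v) is a model of Q_p: a field of characteristic 0 with a discrete valuation v
  (value v 0 irrelevant, read as +infinity) extending the p-adic valuation of Q,
  complete, and in which Q is dense.\<close>
definition is_Qp :: "nat \<Rightarrow> ('k::field_char_0 \<Rightarrow> int) \<Rightarrow> bool" where
  "is_Qp p v \<longleftrightarrow>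
     (\<forall>x y. x \<noteq> 0 \<longrightarrow> y \<noteq> 0 \<longrightarrow> v (x * y) = v x + v y) \<and>
     (\<forall>x y. x \<noteq> 0 \<longrightarrow> y \<noteq> 0 \<longrightarrow> x + y \<noteq> 0 \<longrightarrow> min (v x) (v y) \<le> v (x + y)) \<and>
     (\<forall>q. q \<noteq> 0 \<longrightarrow> v (of_rat q) = padic_val_rat p q) \<and>
     (\<forall>s::nat \<Rightarrow> 'k. (\<forall>n. \<exists>N. \<forall>i j. N \<le> i \<longrightarrow> N \<le> j \<longrightarrow> vclose v n (s i) (s j))
          \<longrightarrow> (\<exists>l. \<forall>n. \<exists>N. \<forall>i. N \<le> i \<longrightarrow> vclose v n (s i) l)) \<and>
     (\<forall>x n. \<exists>q. vclose v n x (of_rat q))"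

text \<open>Canonical p-adic divisibility on Q_p: x | y iff v(x) \<le> v(y), with v(0) = infinity.\<close>
definition vdvd :: "('k::field \<Rightarrow> int) \<Rightarrow> 'k \<Rightarrow> 'k \<Rightarrow> bool" where
  "vdvd v x y \<longleftrightarrow> y = 0 \<or> (x \<noteq> 0 \<and> v x \<le> v y)"

definition pabs :: "nat \<Rightarrow> ('k::field \<Rightarrow> int) \<Rightarrow> 'k \<Rightarrow> real" where
  "pabs p v x = (if x = 0 then 0 else real p powr (- real_of_int (v x)))"

definition Qp_top :: "('k::field \<Rightarrow> int) \<Rightarrow> 'k topology" where
  "Qp_top v = topology_generated_by {{y. vclose v n c y} | c n. True}"

definition is_divisibility :: "('a::comm_ring_1 \<Rightarrow> 'a \<Rightarrow> bool) \<Rightarrow> bool" where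
  "is_divisibility d \<longleftrightarrow>
     (\<forall>a. d a a) \<and>
     (\<forall>a b c. d a b \<longrightarrow> d b c \<longrightarrow> d a c) \<and>
     (\<forall>a b c. d a b \<longrightarrow> d a c \<longrightarrow> d a (b - c)) \<and>
     (\<forall>a b c. d a b \<longrightarrow> d (a * c) (b * c)) \<and>
     \<not> d 0 1"

definition is_pdivisibility :: "nat \<Rightarrow> ('a::comm_ring_1 \<Rightarrow> 'a \<Rightarrow> bool) \<Rightarrow> bool" where
  "is_pdivisibility p d \<longleftrightarrow> is_divisibility d \<and>
     (\<forall>a. \<not> d 0 a \<longrightarrow> \<not> d (of_nat p * a) a) \<and>
     (\<forall>a b. d (of_nat p * ((a ^ p * b - b ^ p * a)\<^sup>2 - (b ^ (p + 1))\<^sup>2))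
               ((a ^ p * b - b ^ p * a) * b ^ (p + 1)))"

text \<open>p-archimedean: every a is divisible by some p^m, m an integer
  (p^m for m<0 is the inverse of p^(-m) in A).\<close>
definition p_archimedean :: "nat \<Rightarrow> ('a::comm_ring_1 \<Rightarrow> 'a \<Rightarrow> bool) \<Rightarrow> bool" where
  "p_archimedean p d \<longleftrightarrow>
     (\<forall>a. \<exists>m::int. \<exists>c. (if 0 \<le> m then c = of_nat p ^ nat m else c * of_nat p ^ nat (- m) = 1)
                     \<and> d c a)"

definition Spec_Dp :: "nat \<Rightarrow> ('a::comm_ring_1 \<Rightarrow> 'a \<Rightarrow> bool) \<Rightarrow> ('a \<Rightarrow> 'a \<Rightarrow> bool) set" where
  "Spec_Dp p d0 = {d. is_pdivisibility p d \<and> (\<forall>a b. d0 a b \<longrightarrow> d a b) \<and>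
                       (\<forall>a b. d a b \<or> d b a) \<and>
                       (\<forall>a b c. \<not> d 0 c \<longrightarrow> d (a * c) (b * c) \<longrightarrow> d a b)}"

definition Spec_max_Dp :: "nat \<Rightarrow> ('a::comm_ring_1 \<Rightarrow> 'a \<Rightarrow> bool) \<Rightarrow> ('a \<Rightarrow> 'a \<Rightarrow> bool) set" where
  "Spec_max_Dp p d0 = {d \<in> Spec_Dp p d0. \<forall>d' \<in> Spec_Dp p d0. (\<forall>a b. d a b \<longrightarrow> d' a b) \<longrightarrow> d' = d}"

definition spec_top :: "('a \<Rightarrow> 'a \<Rightarrow> bool) set \<Rightarrow> ('a \<Rightarrow> 'a \<Rightarrow> bool) topology" where
  "spec_top X = topology_generated_by (insert X {{d \<in> X. \<not> d a b} | a b. True})"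

definition is_ring_hom :: "('a::comm_ring_1 \<Rightarrow> 'k::field) \<Rightarrow> bool" where
  "is_ring_hom f \<longleftrightarrow> f 1 = 1 \<and> (\<forall>a b. f (a + b) = f a + f b) \<and> (\<forall>a b. f (a * b) = f a * f b)"

text \<open>alpha_d : A \<rightarrow> Q_p: the ring homomorphism A \<rightarrow> A/I(d) \<subseteq> F \<hookrightarrow> Q_p inducing d,
  i.e. the unique ring homomorphism alpha with (a | b \<longleftrightarrow> v(alpha a) \<le> v(alpha b)).\<close>
definition alpha_hom :: "('k::field \<Rightarrow> int) \<Rightarrow> ('a::comm_ring_1 \<Rightarrow> 'a \<Rightarrow> bool) \<Rightarrow> 'a \<Rightarrow> 'k" where
  "alpha_hom v d = (THE \<alpha>. is_ring_hom \<alpha> \<and> (\<forall>a b. d a b \<longleftrightarrow> vdvd v (\<alpha> a) (\<alpha> b)))"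

definition hat :: "('k::field \<Rightarrow> int) \<Rightarrow> 'a::comm_ring_1 \<Rightarrow> ('a \<Rightarrow> 'a \<Rightarrow> bool) \<Rightarrow> 'k" where
  "hat v a d = alpha_hom v d a"

end

theory Submission
  imports Defs "HOL-Computational_Algebra.Polynomial"
begin

text \<open>
  A maximal $p$-divisibility is determined by its filtration $v(a) \ge n$, that is $p^n \mid a$, which is
  the filtration of a ${\bf Z}$-valued valuation with $v(p) = 1$ and residue field ${\bf F}_p$. Hence
  ${\bf Z}[1/p]$ is dense in $A$ for this valuation, and comparing approximations yields the unique homomorphism
  to ${\bf Q}_p$. The sets where $v(a) \ge n$ are open and closed, which gives continuity of $\widehat a$.
  For density, if $a$ is integral everywhere then $a^{(p-1)p^N}$ converges uniformly to the indicator of the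
  set where $a$ is a unit; these sets generate indicators of a basis of neighbourhoods, and since the
  spectrum is compact, a continuous function is uniformly approximated by finite
  combinations of such indicators with coefficients in ${\bf Z}[1/p]$.
\<close>

subsection \<open>p-adic filtrations\<close>

text \<open>The filtration axioms are chosen so that A at a point of X and Q_p become two instances
  of one structure; the embedding then reduces to their agreement on Z[1/p]. Axiom (7) enters at b =
  1, as p | a^p - a for integral a. It serves twice: it makes p an element of least positive value,
  and it bounds the residue field. Maximality is not visibly a closed condition on relations, which
  is the obstacle to compactness. Filtrations indexed by the integers get around it: they do not
  distinguish elements of infinite value, so every filtration compatible with \<open>d0\<close>
  yields a maximal divisibility, and only finitary axioms remain. The archimedean bounds come from
  \<open>d0\<close> itself, hence are the same at all points of X. This keeps errors uniform when
  approximate indicators are multiplied by elements of A.\<close>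

definition ppow :: "nat \<Rightarrow> 'a::comm_ring_1 \<Rightarrow> int \<Rightarrow> 'a" where
  "ppow p i m = (if 0 \<le> m then of_nat p ^ nat m else i ^ nat (- m))"

lemma ppow_0 [simp]: "ppow p i 0 = 1"
  by (simp add: ppow_def)

lemma ppow_1 [simp]: "ppow p i 1 = of_nat p"
  by (simp add: ppow_def)

lemma ppow_succ:
  assumes "of_nat p * i = 1"
  shows "ppow p i (m + 1) = of_nat p * ppow p i m"
proof (cases "0 \<le> m")
  case True
  then have "nat (m + 1) = Suc (nat m)" by simp
  with True show ?thesis by (simp add: ppow_def)
next
  case False
  then have "nat (- m) = Suc (nat (- (m + 1)))" by simp
  with False show ?thesis using assms
    by (auto simp: ppow_def mult.assoc[symmetric])
qed

lemma ppow_add: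
  assumes "of_nat p * i = 1"
  shows "ppow p i (m + n) = ppow p i m * ppow p i n"
proof (induction n rule: int_induct[where k = 0])
  case (step1 n)
  then show ?case
    using ppow_succ[OF assms, of "m + n"] ppow_succ[OF assms, of n]
    by (simp add: algebra_simps)
next
  case (step2 n)
  have *: "ppow p i (k - 1) = i * ppow p i k" for k
    using arg_cong[OF ppow_succ[OF assms, of "k - 1"], of "(*) i"] assms
    by (simp add: mult.assoc[symmetric] mult.commute)
  show ?case
    using step2 *[of "m + n"] *[of n] by (simp add: algebra_simps)
qed simp

lemma ppow_inverse:
  assumes "of_nat p * i = 1"
  shows "ppow p i m * ppow p i (- m) = 1"
  using ppow_add[OF assms, of m "- m"] by simp

text \<open>A pair $(z, m)$ encodes $z p^m \in {\bf Z}[1/p]$. This ring is dense in both $A$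
  and ${\bf Q}_p$, which are compared through it.\<close>

definition zpow :: "nat \<Rightarrow> 'a::comm_ring_1 \<Rightarrow> int \<times> int \<Rightarrow> 'a" where
  "zpow p i r = of_int (fst r) * ppow p i (snd r)"

text \<open>Arithmetic is done on the codes, with the smaller exponent as common denominator, so
  that one code denotes the result in both rings.\<close>

definition zpow_diff :: "nat \<Rightarrow> int \<times> int \<Rightarrow> int \<times> int \<Rightarrow> int \<times> int" where
  "zpow_diff p r s = (let k = min (snd r) (snd s) in
     (fst r * int p ^ nat (snd r - k) - fst s * int p ^ nat (snd s - k), k))"

definition zpow_mult :: "int \<times> int \<Rightarrow> int \<times> int \<Rightarrow> int \<times> int" where
  "zpow_mult r s = (fst r * fst s, snd r + snd s)"

lemma zpow_diff:
  assumes "of_nat p * i = 1"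
  shows "zpow p i (zpow_diff p r s) = zpow p i r - zpow p i s"
proof -
  have *: "of_nat p ^ nat (m - k) * ppow p i k = ppow p i m" if "k \<le> m" for m k
    using ppow_add[OF assms, of "m - k" k] that by (simp add: ppow_def)
  show ?thesis
    by (simp add: zpow_def zpow_diff_def Let_def left_diff_distrib mult.assoc *)
qed

lemma zpow_mult:
  assumes "of_nat p * i = 1"
  shows "zpow p i (zpow_mult r s) = zpow p i r * zpow p i s"
  by (simp add: zpow_def zpow_mult_def ppow_add[OF assms] ac_simps)

text \<open>$P\,n\,a$ stands for $v(a) \ge n$, where $v$ is a valuation, possibly with nontrivial support,
  with values in the integers and $v(p) = 1$. Since $p$ is a unit, no fraction field is needed to normalize
  valuations.\<close>

locale padic_filtration =
  fixes p :: nat and i :: "'a::comm_ring_1" and P :: "int \<Rightarrow> 'a \<Rightarrow> bool"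
  assumes prime_p: "prime p"
    and inv_p: "of_nat p * i = 1"
    and diff: "P n a \<Longrightarrow> P n b \<Longrightarrow> P n (a - b)"
    and mult: "P n a \<Longrightarrow> P m b \<Longrightarrow> P (n + m) (a * b)"
    and mult_less: "\<not> P (n + 1) a \<Longrightarrow> \<not> P (m + 1) b \<Longrightarrow> \<not> P (n + m + 1) (a * b)"
    and pred: "P (n + 1) a \<Longrightarrow> P n a"
    and p_mult: "P (n + 1) (of_nat p * a) \<longleftrightarrow> P n a"
    and one: "P 0 1"
    and not_one: "\<not> P 1 1"
begin

abbreviation "\<pi> \<equiv> ppow p i"
abbreviation "\<rho> \<equiv> zpow p i"

lemma antimono:
  assumes "P n a" "m \<le> n"
  shows "P m a"
  using assms(2)
proof (induction m rule: int_le_induct)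
  case (step m)
  then show ?case using pred[of "m - 1" a] by simp
qed (fact assms(1))

lemma ppow_mult: "P n (\<pi> m * a) \<longleftrightarrow> P (n - m) a"
proof (induction m arbitrary: n rule: int_induct[where k = 0])
  case (step1 m)
  then show ?case
    using p_mult[of "n - 1" "\<pi> m * a"]
    by (simp add: ppow_succ[OF inv_p] mult.assoc diff_diff_eq) (simp add: add.commute)
next
  case (step2 m)
  have "P n (\<pi> (m - 1) * a) \<longleftrightarrow> P (n + 1) (\<pi> m * a)"
    using p_mult[of n "\<pi> (m - 1) * a"] ppow_succ[OF inv_p, of "m - 1"]
    by (simp add: mult.assoc)
  with step2 show ?case by (simp add: algebra_simps)
qed simp

lemma ppow_iff: "P n (\<pi> m) \<longleftrightarrow> n \<le> m"
proof -
  have "P n (\<pi> m) \<longleftrightarrow> P (n - m) 1" using ppow_mult[of n m 1] by simp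
  also have "\<dots> \<longleftrightarrow> n \<le> m"
    using antimono[OF one, of "n - m"] antimono[of "n - m" 1 1] not_one by force
  finally show ?thesis .
qed

lemma zero: "P n 0"
  using diff[of n "\<pi> n" "\<pi> n"] by (simp add: ppow_iff)

lemma uminus: "P n a \<Longrightarrow> P n (- a)"
  using diff[OF zero] by fastforce

lemma add: "P n a \<Longrightarrow> P n b \<Longrightarrow> P n (a + b)"
  using diff[OF _ uminus, of n a b] by simp

lemma diff_commute: "P n (a - b) \<longleftrightarrow> P n (b - a)"
  using uminus[of n "a - b"] uminus[of n "b - a"] by auto

lemma diff_trans: "P n (a - b) \<Longrightarrow> P n (b - c) \<Longrightarrow> P n (a - c)"
  using add[of n "a - b" "b - c"] by simp

lemma diff_cong: "P n (a - c) \<Longrightarrow> P n (a - b) \<longleftrightarrow> P n (b - c)"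
  using diff_trans[of n b a c] diff_commute[of n a b] diff_trans[of n a c b] diff_commute[of n b c]
  by blast

lemma cong_iff: "P n (a - b) \<Longrightarrow> P n a \<longleftrightarrow> P n b"
  using add[of n "a - b" b] diff[of n a "a - b"] by auto

lemma integral_mult: "P 0 a \<Longrightarrow> P n b \<Longrightarrow> P n (a * b)"
  using mult[of 0 a n b] by simp

lemma integral_power: "P 0 a \<Longrightarrow> P 0 (a ^ n)"
  by (induction n) (auto simp: one integral_mult)

lemma power_ge: "P 1 a \<Longrightarrow> P (int n) (a ^ n)"
proof (induction n)
  case (Suc n)
  then show ?case using mult[of 1 a "int n" "a ^ n"] by simp
qed (simp add: one)

lemma prime_mult: "P 1 (a * b) \<Longrightarrow> P 1 a \<or> P 1 b"
  using mult_less[of 0 a 0 b] by auto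

lemma integral_of_nat: "P 0 (of_nat n)"
  by (induction n) (auto simp: zero one add)

lemma integral_of_int: "P 0 (of_int z)"
  by (cases z) (auto simp: integral_of_nat intro!: diff one uminus)

text \<open>An integer prime to p cannot have positive value, because a Bezout relation with p would
  then give 1 positive value.\<close>

lemma p_dvd_of_int: "P 1 (of_int z) \<longleftrightarrow> int p dvd z"
proof
  assume "int p dvd z"
  then obtain w where "z = int p * w" by (elim dvdE)
  then show "P 1 (of_int z)"
    using p_mult[of 0 "of_int w"] integral_of_int[of w] by simp
next
  assume z: "P 1 (of_int z)"
  show "int p dvd z"
  proof (rule ccontr)
    assume "\<not> int p dvd z"
    then have "coprime (int p) z"
      using prime_p by (intro prime_imp_coprime) auto
    then obtain s t where "s * int p + t * z = 1"
      by (metis bezout_int coprime_imp_gcd_eq_1)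
    then have "(1 :: 'a) = of_nat p * of_int s + of_int t * of_int z"
      by (metis mult.commute of_int_1 of_int_add of_int_mult of_int_of_nat_eq)
    moreover have "P 1 (of_nat p * of_int s)"
      using p_mult[of 0 "of_int s"] integral_of_int by simp
    ultimately show False
      using add[OF _ integral_mult[OF integral_of_int[of t] z]] not_one by metis
  qed
qed

lemma of_int_iff: "P (int n) (of_int z) \<longleftrightarrow> int p ^ n dvd z"
proof (induction n arbitrary: z)
  case (Suc n)
  show ?case
  proof (cases "int p dvd z")
    case True
    then obtain w where w: "z = int p * w" by (elim dvdE)
    then show ?thesis
      using p_mult[of "int n" "of_int w"] Suc[of w] prime_p by (auto simp: algebra_simps)
  next
    case False
    then have "\<not> P (int (Suc n)) (of_int z)"
      using p_dvd_of_int[of z] antimono[of "int (Suc n)" "of_int z" 1] by auto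
    with False show ?thesis using dvd_trans by fastforce
  qed
qed (simp add: integral_of_int)

text \<open>The right side mentions neither the ring nor the filtration, so any two filtrations
  agree on Z[1/p]. Truncation by \<open>nat\<close> is harmless, as integers have nonnegative
  value.\<close>

lemma zpow_iff: "P n (\<rho> (z, m)) \<longleftrightarrow> int p ^ nat (n - m) dvd z"
proof -
  have "P n (\<rho> (z, m)) \<longleftrightarrow> P (n - m) (of_int z)"
    using ppow_mult[of n m "of_int z"] by (simp add: zpow_def mult.commute)
  also have "\<dots> \<longleftrightarrow> P (int (nat (n - m))) (of_int z)"
    using antimono[OF integral_of_int, of "n - m" z] integral_of_int[of z]
    by (cases "0 \<le> n - m") (auto simp del: of_nat_nat)
  finally show ?thesis by (simp only: of_int_iff)
qed

lemma exact_value: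
  assumes "P m a" "\<not> P n a"
  obtains k where "P k a" "\<not> P (k + 1) a"
proof -
  have "m \<le> n" using assms antimono by (meson linorder_le_cases)
  then have "\<not> P n a \<longrightarrow> (\<exists>k. P k a \<and> \<not> P (k + 1) a)"
    by (induction n rule: int_ge_induct) (use assms in auto)
  then show ?thesis using assms that by blast
qed

lemma mult_cancel:
  assumes "P (n + m) (a * b)" "\<not> P (m + 1) b"
  shows "P n a"
  using mult_less[of "n - 1" a m b] assms by auto

text \<open>A monic polynomial whose degree equals the number of its integer roots modulo $p$ has no
  further roots in the residue field. Applied to $X^p - X$, this identifies the residue field with
  the field of $p$ elements.\<close>

lemma residue_root_count:
  fixes f :: "int poly"
  assumes "P 0 a" "finite S" "\<And>k. k \<in> S \<Longrightarrow> int p dvd poly f k"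
    and "\<And>k l. k \<in> S \<Longrightarrow> l \<in> S \<Longrightarrow> int p dvd k - l \<Longrightarrow> k = l"
    and "lead_coeff f = 1" "degree f = card S"
    and "P 1 (poly (map_poly of_int f) a)"
  shows "\<exists>k\<in>S. P 1 (a - of_int k)"
  using assms(2-)
proof (induction S arbitrary: f rule: finite_induct)
  case empty
  then obtain c where "f = [:c:]" by (metis card.empty degree_eq_zeroE)
  with empty not_one show ?case by (simp add: map_poly_pCons)
next
  case (insert k S)
  \<comment> \<open>Splitting off the root k leaves integer coefficients, so no residue ring is
    formed; the remainder \<open>poly f k\<close> vanishes modulo p.\<close>
  define g where "g = synthetic_div f k"
  have f: "f = [:- k, 1:] * g + [:poly f k:]"
    unfolding g_def by (rule synthetic_div_correct'[symmetric])
  have deg: "degree f = Suc (card S)" using insert by simp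
  have g: "degree g = card S" using deg by (simp add: g_def degree_synthetic_div)
  have "g \<noteq> 0" using deg by (auto simp: g_def synthetic_div_eq_0_iff)
  have "lead_coeff f = coeff ([:- k, 1:] * g) (Suc (card S))"
    using deg by (subst f) simp
  also have "\<dots> = lead_coeff g"
    using g by (simp add: coeff_eq_0)
  finally have lead: "lead_coeff g = 1" using insert.prems by simp
  have "poly (map_poly of_int f) a
      = (a - of_int k) * poly (map_poly of_int g) a + of_int (poly f k)"
  proof -
    have *: "poly (map_poly of_int q) a = (a - of_int k) * poly (map_poly of_int (synthetic_div q k)) a
        + of_int (poly q k)" for q
    proof (induction q)
      case (pCons c q)
      have "a * poly (map_poly of_int q) a = a * ((a - of_int k) * poly (map_poly of_int (synthetic_div q k)) a
        + of_int (poly q k))"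
        using pCons.IH by simp
      also have "\<dots> + of_int c = (a - of_int k) * (of_int (poly q k)
          + a * poly (map_poly of_int (synthetic_div q k)) a) + of_int (c + k * poly q k)"
        by (simp add: algebra_simps)
      finally show ?case by (simp add: map_poly_pCons add.commute)
    qed simp
    show ?thesis unfolding g_def by (rule *)
  qed
  moreover have "P 1 (of_int (poly f k))"
    using insert.prems(1) p_dvd_of_int by blast
  ultimately have "P 1 ((a - of_int k) * poly (map_poly of_int g) a)"
    using insert.prems(5) diff by fastforce
  then consider "P 1 (a - of_int k)" | "P 1 (poly (map_poly of_int g) a)"
    using prime_mult by blast
  then show ?case
  proof cases
    case 2
    have "int p dvd poly g l" if l: "l \<in> S" for l
    proof -
      have "poly f l = (l - k) * poly g l + poly f k"
        by (subst f) (simp add: algebra_simps)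
      then have "int p dvd (l - k) * poly g l"
        using insert.prems(1)[of l] insert.prems(1)[of k] l by (metis dvd_add_left_iff insertCI)
      moreover have "\<not> int p dvd l - k"
        using insert.prems(2)[of l k] insert.hyps l by auto
      ultimately show ?thesis
        using prime_p by (meson prime_dvd_multD prime_int_nat_transfer prime_nat_int_transfer)
    qed
    with insert.IH[of g] 2 lead g insert.prems(2) show ?thesis by blast
  qed auto
qed

lemma residue_digit:
  assumes kochen: "\<And>b. P 0 b \<Longrightarrow> P 1 (b ^ p - b)" and "P 0 a"
  shows "\<exists>k. P 1 (a - of_int k)"
proof -
  define f :: "int poly" where "f = monom 1 p - monom 1 1"
  have p: "1 < p" using prime_p prime_gt_1_nat by blast
  have deg: "degree f = p"
    using p by (intro antisym degree_le le_degree) (auto simp: f_def)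
  have "\<exists>k\<in>int ` {..<p}. P 1 (a - of_int k)"
  proof (rule residue_root_count[of a _ f])
    fix k :: int
    \<comment> \<open>Fermat's little theorem is the hypothesis at the integral element k, read back
      in the integers through \<open>p_dvd_of_int\<close>.\<close>
    have "P 1 (of_int (k ^ p - k))" using kochen[OF integral_of_int[of k]] by simp
    then show "int p dvd poly f k" by (simp only: p_dvd_of_int f_def poly_diff poly_monom) simp
  next
    fix k l assume "k \<in> int ` {..<p}" "l \<in> int ` {..<p}" "int p dvd k - l"
    then show "k = l" using zdvd_imp_le[of "int p" "k - l"] zdvd_imp_le[of "int p" "l - k"]
      by (auto simp: dvd_diff_commute) (metis (no_types, lifting) linorder_neqE_nat of_nat_less_iff
        mod_eq_dvd_iff mod_less of_nat_mod of_nat_eq_iff dvd_diff_commute)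
  next
    show "lead_coeff f = 1" using p unfolding deg by (simp add: f_def)
    show "degree f = card (int ` {..<p})" by (simp add: deg card_image)
    have "poly (map_poly of_int f) a = (a ^ p - a)"
    proof -
      have "map_poly of_int f = (monom 1 p - monom 1 1 :: 'a poly)"
        by (rule poly_eqI) (simp add: coeff_map_poly f_def)
      then show ?thesis by (simp add: poly_monom)
    qed
    then show "P 1 (poly (map_poly of_int f) a)" using kochen assms(2) by simp
  qed (use assms in auto)
  then show ?thesis by blast
qed

text \<open>Digit expansion starting at p^m: the remainder, rescaled to be integral, is congruent to
  an integer modulo p, and that integer is the next digit.\<close>

lemma approx_zpow:
  assumes kochen: "\<And>b. P 0 b \<Longrightarrow> P 1 (b ^ p - b)" and "P m a"
  shows "\<exists>r. P n (a - \<rho> r)"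
proof -
  have "\<exists>z. P (m + int j) (a - of_int z * \<pi> m)" for j
  proof (induction j)
    case 0
    have "P (m + int 0) (a - of_int 0 * \<pi> m)" using assms(2) by simp
    then show ?case by blast
  next
    case (Suc j)
    then obtain z where z: "P (m + int j) (a - of_int z * \<pi> m)" (is "P _ ?b") by blast
    then have "P 0 (\<pi> (- (m + int j)) * ?b)"
      by (subst ppow_mult) (simp add: add.commute)
    then obtain k where "P 1 (\<pi> (- (m + int j)) * ?b - of_int k)"
      using residue_digit[OF kochen] by blast
    then have "P (1 + (m + int j)) (\<pi> (m + int j) * (\<pi> (- (m + int j)) * ?b - of_int k))"
      by (subst ppow_mult) simp
    also have "\<pi> (m + int j) * (\<pi> (- (m + int j)) * ?b - of_int k)
        = \<pi> (m + int j) * \<pi> (- (m + int j)) * ?b - of_int k * \<pi> (m + int j)"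
      by (simp add: algebra_simps)
    also have "\<dots> = ?b - of_int k * \<pi> (m + int j)"
      using ppow_inverse[OF inv_p, of "m + int j"] by simp
    also have "\<dots> = a - of_int (z + k * int p ^ j) * \<pi> m"
      by (simp add: ppow_add[OF inv_p] algebra_simps) (simp add: ppow_def)
    finally show ?case by (intro exI[of _ "z + k * int p ^ j"])
        (simp only: of_nat_Suc add.assoc add.left_commute add.commute)
  qed
  then obtain z where "P (m + int (nat (n - m))) (a - of_int z * \<pi> m)" by blast
  then have "P n (a - \<rho> (z, m))"
    by (auto simp: zpow_def intro: antimono)
  then show ?thesis by blast
qed

end

subsection \<open>The valuations of maximal p-divisibilities\<close>

lemma Spec_DpD:
  assumes "d \<in> Spec_Dp p d0"
  shows "d a a" "d a b \<Longrightarrow> d b c \<Longrightarrow> d a c" "d a b \<Longrightarrow> d a c \<Longrightarrow> d a (b - c)"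
    "d a b \<Longrightarrow> d (a * c) (b * c)" "\<not> d 0 1" "\<not> d 0 a \<Longrightarrow> \<not> d (of_nat p * a) a"
    "d (of_nat p * ((a ^ p * b - b ^ p * a)\<^sup>2 - (b ^ (p + 1))\<^sup>2))
      ((a ^ p * b - b ^ p * a) * b ^ (p + 1))"
    "d0 a b \<Longrightarrow> d a b" "d a b \<or> d b a" "\<not> d 0 c \<Longrightarrow> d (a * c) (b * c) \<Longrightarrow> d a b"
proof -
  have D: "\<forall>a. d a a" "\<forall>a b c. d a b \<longrightarrow> d b c \<longrightarrow> d a c" "\<forall>a b c. d a b \<longrightarrow> d a c \<longrightarrow> d a (b - c)"
    "\<forall>a b c. d a b \<longrightarrow> d (a * c) (b * c)" "\<not> d 0 1" "\<forall>a. \<not> d 0 a \<longrightarrow> \<not> d (of_nat p * a) a"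
    "\<forall>a b. d (of_nat p * ((a ^ p * b - b ^ p * a)\<^sup>2 - (b ^ (p + 1))\<^sup>2))
      ((a ^ p * b - b ^ p * a) * b ^ (p + 1))"
    "\<forall>a b. d0 a b \<longrightarrow> d a b" "\<forall>a b. d a b \<or> d b a" "\<forall>a b c. \<not> d 0 c \<longrightarrow> d (a * c) (b * c) \<longrightarrow> d a b"
    using assms unfolding Spec_Dp_def is_pdivisibility_def is_divisibility_def
    by - (elim CollectE conjE, assumption)+
  show "d a a" "\<not> d 0 1" "d a b \<or> d b a"
    "d (of_nat p * ((a ^ p * b - b ^ p * a)\<^sup>2 - (b ^ (p + 1))\<^sup>2))
      ((a ^ p * b - b ^ p * a) * b ^ (p + 1))"
    using D(1,5,7,9) by simp_all
  show "d a b \<Longrightarrow> d b c \<Longrightarrow> d a c" by (rule D(2)[rule_format])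
  show "d a b \<Longrightarrow> d a c \<Longrightarrow> d a (b - c)" by (rule D(3)[rule_format])
  show "d a b \<Longrightarrow> d (a * c) (b * c)" by (rule D(4)[rule_format])
  show "\<not> d 0 a \<Longrightarrow> \<not> d (of_nat p * a) a" by (rule D(6)[rule_format])
  show "d0 a b \<Longrightarrow> d a b" by (rule D(8)[rule_format])
  show "\<not> d 0 c \<Longrightarrow> d (a * c) (b * c) \<Longrightarrow> d a b" by (rule D(10)[rule_format])
qed

text \<open>Axiom (7) asserts divisibilities unconditionally, so it passes from \<open>d0\<close> to
  every larger relation. Axiom (6) is conditional and has to be checked for
  \<open>d\<close>.\<close>

lemma Spec_DpI:
  assumes "\<And>a. d a a" "\<And>a b c. d a b \<Longrightarrow> d b c \<Longrightarrow> d a c"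
    "\<And>a b c. d a b \<Longrightarrow> d a c \<Longrightarrow> d a (b - c)" "\<And>a b c. d a b \<Longrightarrow> d (a * c) (b * c)" "\<not> d 0 1"
    "\<And>a. \<not> d 0 a \<Longrightarrow> \<not> d (of_nat p * a) a" "is_pdivisibility p d0" "\<And>a b. d0 a b \<Longrightarrow> d a b"
    "\<And>a b. d a b \<or> d b a" "\<And>a b c. \<not> d 0 c \<Longrightarrow> d (a * c) (b * c) \<Longrightarrow> d a b"
  shows "d \<in> Spec_Dp p d0"
proof -
  have "is_divisibility d"
    unfolding is_divisibility_def using assms(1-5) by (intro conjI allI impI)
  moreover have "d (of_nat p * ((a ^ p * b - b ^ p * a)\<^sup>2 - (b ^ (p + 1))\<^sup>2))
      ((a ^ p * b - b ^ p * a) * b ^ (p + 1))" for a b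
    using assms(7) by (intro assms(8)) (simp add: is_pdivisibility_def)
  ultimately show ?thesis
    unfolding Spec_Dp_def is_pdivisibility_def mem_Collect_eq
    using assms(6,8-10) by (intro conjI allI impI)
qed

locale archimedean_pdivisibility =
  fixes p :: nat and i :: "'a::comm_ring_1" and d0 :: "'a \<Rightarrow> 'a \<Rightarrow> bool"
  assumes prime_p: "prime p"
    and inv_p: "of_nat p * i = 1"
    and pdiv: "is_pdivisibility p d0"
    and arch: "p_archimedean p d0"
begin

abbreviation "\<pi> \<equiv> ppow p i"
abbreviation "\<rho> \<equiv> zpow p i"

lemma lower_bound: "\<exists>m. d0 (\<pi> m) a"
proof -
  obtain m c where m: "if 0 \<le> m then c = of_nat p ^ nat m else c * of_nat p ^ nat (- m) = 1"
    and c: "d0 c a"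
    using arch unfolding p_archimedean_def by blast
  have "c = \<pi> m"
  proof (cases "0 \<le> m")
    case False
    have "of_nat p ^ nat (- m) * i ^ nat (- m) = 1"
      by (simp add: power_mult_distrib[symmetric] inv_p)
    then have "c = c * of_nat p ^ nat (- m) * i ^ nat (- m)" by (simp add: mult.assoc)
    also have "\<dots> = \<pi> m" using False m by (simp add: ppow_def)
    finally show ?thesis .
  qed (use m in \<open>simp add: ppow_def\<close>)
  with c show ?thesis by blast
qed

section \<open>Valuation theory of a single divisibility in the spectrum\<close>

context
  fixes d assumes d: "d \<in> Spec_Dp p d0"
begin

lemma refl: "d a a" by (rule Spec_DpD[OF d])
lemma trans: "d a b \<Longrightarrow> d b c \<Longrightarrow> d a c" by (rule Spec_DpD[OF d])
lemma diff: "d a b \<Longrightarrow> d a c \<Longrightarrow> d a (b - c)" by (rule Spec_DpD[OF d])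
lemma mult_right: "d a b \<Longrightarrow> d (a * c) (b * c)" by (rule Spec_DpD[OF d])
lemma not_0_1: "\<not> d 0 1" by (rule Spec_DpD[OF d])
lemma p_not_unit: "\<not> d 0 a \<Longrightarrow> \<not> d (of_nat p * a) a" by (rule Spec_DpD[OF d])
lemma total: "d a b \<or> d b a" by (rule Spec_DpD[OF d])
lemma cancel: "\<not> d 0 c \<Longrightarrow> d (a * c) (b * c) \<Longrightarrow> d a b" by (rule Spec_DpD[OF d])
lemma contains: "d0 a b \<Longrightarrow> d a b" by (rule Spec_DpD[OF d])

lemma zero: "d a 0"
  using diff[OF refl refl, of a] by simp

lemma uminus: "d a b \<Longrightarrow> d a (- b)"
  using diff[OF zero, of a b] by simp

lemma add: "d a b \<Longrightarrow> d a c \<Longrightarrow> d a (b + c)"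
  using diff[OF _ uminus, of a b c] by simp

lemma mult: "d a b \<Longrightarrow> d a' b' \<Longrightarrow> d (a * a') (b * b')"
  using trans[of "a * a'" "b * a'" "b * b'"] mult_right[of a b a'] mult_right[of a' b' b]
  by (simp add: mult.commute)

lemma \<pi>_cancel: "d (\<pi> m * a) (\<pi> m * b) \<longleftrightarrow> d a b"
proof
  assume "d (\<pi> m * a) (\<pi> m * b)"
  then have "d (\<pi> m * a * \<pi> (- m)) (\<pi> m * b * \<pi> (- m))" by (rule mult_right)
  moreover have "\<pi> m * c * \<pi> (- m) = c" for c
  proof -
    have "\<pi> m * c * \<pi> (- m) = \<pi> m * \<pi> (- m) * c" by (simp add: ac_simps)
    then show ?thesis by (simp add: ppow_inverse[OF inv_p])
  qed
  ultimately show "d a b" by simp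
qed (simp add: mult refl)

lemma not_0_\<pi>: "\<not> d 0 (\<pi> m)"
  using \<pi>_cancel[of m 0 1] not_0_1 by simp

lemma \<pi>_succ: "\<not> d (\<pi> (m + 1)) (\<pi> m)"
  using p_not_unit[OF not_0_\<pi>] by (simp add: ppow_succ[OF inv_p])

lemma \<pi>_mono: "n \<le> m \<Longrightarrow> d (\<pi> n) (\<pi> m)"
proof (induction m rule: int_ge_induct)
  case (step m)
  have "d 1 (1 :: 'a)" by (rule refl)
  then have one: "d 1 (of_nat k)" for k by (induction k) (auto intro: zero add)
  have "d (\<pi> m) (\<pi> (m + 1))"
    using mult[OF one[of p] refl[of "\<pi> m"]] by (simp add: ppow_succ[OF inv_p])
  from trans[OF step.IH this] show ?case .
qed (rule refl)

lemma integral_one: "d 1 a \<Longrightarrow> d 1 b \<Longrightarrow> d 1 (a * b)"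
  using mult[of 1 a 1 b] by simp

lemma integral_power: "d 1 a \<Longrightarrow> d 1 (a ^ n)"
  by (induction n) (auto intro: refl integral_one)

text \<open>Axiom (7) at b = 1: its left side is p times an integral element, hence a multiple of p,
  and it divides \<open>a ^ p - a\<close>.\<close>

lemma kochen:
  assumes "d 1 a"
  shows "d (of_nat p) (a ^ p - a)"
proof -
  have "d 1 ((a ^ p - a)\<^sup>2 - 1)"
    using assms by (intro diff refl integral_power) 
  then have "d (of_nat p) (of_nat p * ((a ^ p - a)\<^sup>2 - 1))"
    using mult[OF refl[of "of_nat p"], of 1] by simp
  also have "d \<dots> (a ^ p - a)"
    using Spec_DpD(7)[OF d, where a = a and b = 1] by simp
  finally (trans) show ?thesis .
qed

text \<open>Suppose a has value strictly between those of 1 and p. Then a^(p-1) has positive value,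
  1 - a^(p-1) divides 1, and so a^p - a divides a; but p divides a^p - a by \<open>kochen\<close>,
  hence p divides a, a contradiction. Scaling by a power of p gives the general case.\<close>

lemma discrete:
  assumes "\<not> d (\<pi> (n + 1)) a"
  shows "d a (\<pi> n)"
proof -
  have *: "d a 1 \<or> d (of_nat p) a" for a
  proof (rule ccontr)
    assume neg: "\<not> (d a 1 \<or> d (of_nat p) a)"
    then have a: "d 1 a" using total by blast
    define e where "e = a ^ (p - 1)"
    have p: "2 \<le> p" using prime_p prime_ge_2_nat by blast
    have e: "\<not> d e 1"
    proof
      assume "d e 1"
      have "p - 1 = Suc (p - 2)" using p by simp
      then have "e = a * a ^ (p - 2)" by (simp add: e_def)
      then have "d a e" using mult[OF refl integral_power[OF a, of "p - 2"], of a] by simp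
      with \<open>d e 1\<close> neg trans[of a e 1] show False by blast
    qed
    \<comment> \<open>By totality one of e and 1 - e divides the other, hence divides their sum 1;
      since e does not divide 1, it must be 1 - e.\<close>
    have "d (1 - e) 1"
    proof (rule ccontr)
      assume c: "\<not> d (1 - e) 1"
      show False
      proof (cases "d e (1 - e)")
        case True
        then show ?thesis using add[of e "1 - e" e] refl e by auto
      next
        case False
        then show ?thesis using add[of "1 - e" "1 - e" e] total refl c by auto
      qed
    qed
    then have "d (a * (1 - e)) (a * 1)" by (intro mult refl)
    moreover have "d (of_nat p) (- (a ^ p - a))" by (intro uminus kochen a)
    moreover have "a ^ p = a * e" unfolding e_def using p by (cases p) auto
    ultimately show False using trans[of "of_nat p" "a - a * e" a] neg
      by (simp add: right_diff_distrib)
  qed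
  show ?thesis
  proof -
    have pos: "\<pi> n * \<pi> (- n) = 1" using ppow_inverse[OF inv_p] by blast
    then have "\<pi> n * (\<pi> (- n) * a) = a" by (simp add: mult.assoc[symmetric])
    then show ?thesis
      using *[of "\<pi> (- n) * a"] assms \<pi>_cancel[of n "\<pi> (- n) * a" 1]
        \<pi>_cancel[of n "of_nat p" "\<pi> (- n) * a"]
      by (simp add: ppow_succ[OF inv_p] mult.commute)
  qed
qed

text \<open>Expressing the condition as a failure of divisibility makes it open as well as closed on
  the spectrum, and reduces \<open>mult_less\<close> to multiplying divisibilities.\<close>

lemma discrete_iff: "d (\<pi> (n + 1)) a \<longleftrightarrow> \<not> d a (\<pi> n)"
  using discrete[of n a] trans[of "\<pi> (n + 1)" a "\<pi> n"] \<pi>_succ[of n] by blast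

lemma \<pi>_mult: "d (\<pi> n) a \<Longrightarrow> d (\<pi> m) b \<Longrightarrow> d (\<pi> (n + m)) (a * b)"
  by (simp add: ppow_add[OF inv_p] mult)

text \<open>This covers every member of the spectrum, also one with elements of infinite value
  outside its support; the filtration does not distinguish such elements from 0.\<close>

lemma filtration: "padic_filtration p i (\<lambda>n. d (\<pi> n))"
proof
  show "\<not> d (\<pi> (n + m + 1)) (a * b)" if "\<not> d (\<pi> (n + 1)) a" "\<not> d (\<pi> (m + 1)) b" for n m a b
    using that mult[of a "\<pi> n" b "\<pi> m"] unfolding discrete_iff by (simp add: ppow_add[OF inv_p])
  show "d (\<pi> (n + 1)) (of_nat p * a) \<longleftrightarrow> d (\<pi> n) a" for n a
    using \<pi>_cancel[of 1 "\<pi> n" a] by (simp add: ppow_succ[OF inv_p])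
  show "d (\<pi> n) a" if "d (\<pi> (n + 1)) a" for n a
    using trans[OF \<pi>_mono that] by simp
  show "\<not> d (\<pi> 1) 1" using \<pi>_succ[of 0] by simp
  show "d (\<pi> 0) 1" using refl[of 1] by simp
qed (use prime_p inv_p diff \<pi>_mult in auto)

text \<open>Adding the elements divisible by all powers of $p$ to the support yields a larger
  divisibility in the spectrum; hence for a maximal one the value group is archimedean.\<close>

lemma infinite_coarsening: "(\<lambda>a b. (\<forall>n. d (\<pi> n) b) \<or> d a b) \<in> Spec_Dp p d0" (is "?d \<in> _")
proof -
  interpret F: padic_filtration p i "\<lambda>n. d (\<pi> n)" by (rule filtration)
  have bound: "\<exists>m. d (\<pi> m) a" for a
    using lower_bound[of a] by (auto dest: contains)
  \<comment> \<open>An element of finite value divides some power of p, and every power of p divides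
    an element of infinite value.\<close>
  have le: "d a e" if e: "\<forall>n. d (\<pi> n) e" and e': "\<not> (\<forall>n. d (\<pi> n) e')" and "d a e'" for a e e'
  proof -
    from e' obtain n where "\<not> d (\<pi> n) e'" by blast
    then have "d e' (\<pi> (n - 1))" using discrete[of "n - 1" e'] by simp
    from trans[OF trans[OF \<open>d a e'\<close> this] e[rule_format]] show ?thesis .
  qed
  show ?thesis
  proof (rule Spec_DpI)
    show "?d a (b - c)" if "?d a b" "?d a c" for a b c
    proof (cases "(\<forall>n. d (\<pi> n) b) \<and> (\<forall>n. d (\<pi> n) c)")
      case True
      then show ?thesis by (simp add: F.diff)
    next
      case False
      then have "d a b" "d a c" using that le[of b c a] le[of c b a] by blast+
      then show ?thesis by (simp add: diff)
    qed
    show "?d a c" if "?d a b" "?d b c" for a b c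
    proof (cases "\<forall>n. d (\<pi> n) b")
      case True
      then have "d b c \<Longrightarrow> \<forall>n. d (\<pi> n) c" by (intro allI) (rule trans, auto)
      then show ?thesis using that(2) by blast
    next
      case False
      then show ?thesis using that trans[of a b c] by blast
    qed
    show "?d (a * c) (b * c)" if "?d a b" for a b c
    proof (cases "\<forall>n. d (\<pi> n) b")
      case True
      \<comment> \<open>The archimedean bound on c keeps the product of infinite value even if c has
        negative value.\<close>
      obtain m where "d (\<pi> m) c" using bound by blast
      then have "d (\<pi> n) (b * c)" for n using \<pi>_mult[of "n - m" b m c] True by simp
      then show ?thesis by blast
    next
      case False
      with that mult_right[of a b c] show ?thesis by blast
    qed
    show "\<not> ?d 0 1"
    proof
      assume "?d 0 1"
      then have "\<forall>n. d (\<pi> n) 1" using not_0_1 by simp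
      from this[rule_format, of 1] show False using F.not_one by simp
    qed
    show "?d a b" if "\<not> ?d 0 c" "?d (a * c) (b * c)" for a b c
    proof (cases "\<forall>n. d (\<pi> n) (b * c)")
      case True
      obtain m where "d (\<pi> m) c" using bound[of c] ..
      moreover have "\<exists>l. \<not> d (\<pi> l) c" using that(1) by simp
      then obtain l where "\<not> d (\<pi> l) c" ..
      ultimately obtain k where k: "\<not> d (\<pi> (k + 1)) c" by (rule F.exact_value)
      have "d (\<pi> n) b" for n by (rule F.mult_cancel[OF True[rule_format] k])
      then show ?thesis by blast
    next
      case False
      with that cancel[of c a b] show ?thesis by blast
    qed
    show "\<not> ?d (of_nat p * a) a" if "\<not> ?d 0 a" for a
      using that p_not_unit[of a] by blast
    show "?d a b \<or> ?d b a" for a b using total[of a b] by blast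
  qed (simp_all add: refl pdiv contains)
qed

end

text \<open>The coarsening contains \<open>d\<close>, so maximality forces equality. This is where
  maximality is consumed: it puts every element of infinite value into the support.\<close>

lemma Spec_max_archimedean:
  assumes "d \<in> Spec_max_Dp p d0" "\<forall>n. d (\<pi> n) a"
  shows "d 0 a"
proof -
  have d: "d \<in> Spec_Dp p d0" using assms by (simp add: Spec_max_Dp_def)
  have "(\<lambda>a b. (\<forall>n. d (\<pi> n) b) \<or> d a b) = d"
  proof -
    have "d' = d" if "d' \<in> Spec_Dp p d0" "\<And>a b. d a b \<Longrightarrow> d' a b" for d'
      using assms(1) that by (simp add: Spec_max_Dp_def)
    from this[OF infinite_coarsening[OF d]] show ?thesis by simp
  qed
  from fun_cong[OF fun_cong[OF this, of 0], of a] assms(2) show ?thesis by blast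
qed

text \<open>If b has infinite value it lies in the support and everything divides it; otherwise it
  has an exact value, and comparison at that level decides.\<close>

lemma divides_iff_filtration:
  assumes "d \<in> Spec_max_Dp p d0"
  shows "d a b \<longleftrightarrow> (\<forall>n. d (\<pi> n) a \<longrightarrow> d (\<pi> n) b)"
proof -
  have d: "d \<in> Spec_Dp p d0" using assms by (simp add: Spec_max_Dp_def)
  interpret F: padic_filtration p i "\<lambda>n. d (\<pi> n)" by (rule filtration[OF d])
  show ?thesis
  proof
    assume *: "\<forall>n. d (\<pi> n) a \<longrightarrow> d (\<pi> n) b"
    show "d a b"
    proof (cases "\<forall>n. d (\<pi> n) b")
      case True
      show ?thesis
        by (rule trans[OF d zero[OF d] Spec_max_archimedean[OF assms True]])
    next
      case False
      then obtain k where "\<not> d (\<pi> k) b" by blast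
      moreover obtain m where "d (\<pi> m) b" using lower_bound[of b] contains[OF d] by auto
      ultimately obtain n where n: "d (\<pi> n) b" "\<not> d (\<pi> (n + 1)) b"
        using F.exact_value by metis
      then have "d a (\<pi> n)" using * by (intro discrete[OF d]) auto
      from trans[OF d this n(1)] show ?thesis .
    qed
  qed (auto intro: trans[OF d])
qed

text \<open>Needed to exhibit the maximal spectrum as the image of a set of filtrations. Maximality
  is automatic: if a larger relation had a | b with v(a) > v(b) = k, then p^(k+1) would divide b and
  hence p^k in it, against axiom (6).\<close>

lemma filtration_in_Spec_max:
  assumes "padic_filtration p i P" and mono: "\<And>n a b. d0 a b \<Longrightarrow> P n a \<Longrightarrow> P n b"
  defines "d \<equiv> \<lambda>a b. \<forall>n. P n a \<longrightarrow> P n b"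
  shows "d \<in> Spec_max_Dp p d0" and "d (\<pi> n) a \<longleftrightarrow> P n a"
proof -
  interpret F: padic_filtration p i P by fact
  show \<pi>: "d (\<pi> n) a \<longleftrightarrow> P n a" for n a
    unfolding d_def by (auto simp: F.ppow_iff intro: F.antimono)
  have bound: "\<exists>m. P m a" for a
    using lower_bound[of a] mono F.ppow_iff by blast
  have exact: "\<exists>k. P k c \<and> \<not> P (k + 1) c" if c: "\<not> d 0 c" for c
  proof -
    obtain n where "\<not> P n c" using c unfolding d_def by blast
    moreover obtain m where "P m c" using bound by blast
    ultimately show ?thesis using F.exact_value by metis
  qed
  have *: "d (a * c) (b * c)" if "d a b" for a b c
  proof (cases "d 0 c")
    case True
    then have "P n c" for n using F.zero by (simp add: d_def)
    moreover obtain m where "P m b" using bound by blast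
    ultimately have "P n (b * c)" for n using F.mult[of m b "n - m" c] by simp
    then show ?thesis by (simp add: d_def)
  next
    case False
    then obtain k where k: "P k c" "\<not> P (k + 1) c" using exact by blast
    show ?thesis unfolding d_def
    proof (intro allI impI)
      fix n assume "P n (a * c)"
      then have "P (n - k) a" using F.mult_cancel[of "n - k" k] k by simp
      then show "P n (b * c)" using that k F.mult[of "n - k" b k c] by (simp add: d_def)
    qed
  qed
  have "\<not> d (of_nat p * a) a" if "\<not> d 0 a" for a
    using exact[OF that] F.p_mult unfolding d_def by blast
  moreover have "d a b" if c: "\<not> d 0 c" and "d (a * c) (b * c)" for a b c
  proof -
    obtain k where k: "P k c" "\<not> P (k + 1) c" using exact[OF c] by blast
    show ?thesis unfolding d_def
    proof (intro allI impI)
      fix n assume "P n a"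
      then have "P (n + k) (b * c)" using that k F.mult[of n a k c] by (simp add: d_def)
      then show "P n b" using k F.mult_cancel by blast
    qed
  qed
  moreover have contains: "d a b" if "d0 a b" for a b
    using that mono by (simp add: d_def)
  moreover have "d a b \<or> d b a" for a b
    unfolding d_def using F.antimono by (meson linorder_le_cases)
  moreover have "\<not> d 0 1" unfolding d_def using F.zero F.not_one by blast
  moreover have "d a (b - c)" if "d a b" "d a c" for a b c
    using that F.diff by (simp add: d_def)
  moreover have "d a a" for a by (simp add: d_def)
  moreover have "d a c" if "d a b" "d b c" for a b c using that by (simp add: d_def)
  ultimately have spec: "d \<in> Spec_Dp p d0" by (intro Spec_DpI * pdiv)
  show "d \<in> Spec_max_Dp p d0"
    unfolding Spec_max_Dp_def
  proof (intro CollectI conjI ballI impI spec ext)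
    fix d' a b assume d': "d' \<in> Spec_Dp p d0" and le: "\<forall>a b. d a b \<longrightarrow> d' a b"
    have "d a b" if "d' a b"
    proof (rule ccontr)
      assume "\<not> d a b"
      then have nb: "\<not> d 0 b" using F.zero by (auto simp: d_def)
      from \<open>\<not> d a b\<close> obtain n where n: "P n a" "\<not> P n b" by (auto simp: d_def)
      then obtain k where k: "P k b" "\<not> P (k + 1) b" using exact[OF nb] by blast
      have "k + 1 \<le> n" using F.antimono[of k b n] k(1) n(2) by fastforce
      then have "P (k + 1) a" using F.antimono[OF n(1)] by blast
      then have "d' (\<pi> (k + 1)) b" using \<pi> le that trans[OF d', of "\<pi> (k + 1)" a b] by blast
      moreover have "d b (\<pi> k)" unfolding d_def F.ppow_iff using F.antimono[of _ b "k + 1"] k(2) by fastforce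
      ultimately show False
        using le trans[OF d', of "\<pi> (k + 1)" b "\<pi> k"] \<pi>_succ[OF d', of k] by blast
    qed
    with le show "d' a b = d a b" by blast
  qed
qed

end

subsection \<open>Embeddings into the p-adic numbers\<close>

context padic_filtration
begin

text \<open>Split a*b - r*s as (a - r)*b + r*(b - s). Closeness at level m passes the lower bound on
  a to r, which controls the second term.\<close>

lemma mult_approx:
  assumes "P m a" "P l b" "P (n - l) (a - r)" "P m (a - r)" "P (n - m) (b - s)"
  shows "P n (a * b - r * s)"
proof -
  have "P m r" using cong_iff[OF assms(4)] assms(1) by blast
  then have "P n (r * (b - s))" using mult[of m r "n - m" "b - s"] assms(5) by simp
  moreover have "P n ((a - r) * b)" using mult[OF assms(3,2)] by simp
  ultimately show ?thesis using add[of n "(a - r) * b" "r * (b - s)"] by (simp add: algebra_simps)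
qed

end

section \<open>The field Q_p as a filtered ring\<close>

locale padic_field =
  fixes p :: nat and v :: "'k::field_char_0 \<Rightarrow> int"
  assumes prime_p: "prime p" and is_Qp: "is_Qp p v"
begin

lemma v_mult: "x \<noteq> 0 \<Longrightarrow> y \<noteq> 0 \<Longrightarrow> v (x * y) = v x + v y"
  using is_Qp by (simp add: is_Qp_def)

lemma v_add: "x \<noteq> 0 \<Longrightarrow> y \<noteq> 0 \<Longrightarrow> x + y \<noteq> 0 \<Longrightarrow> min (v x) (v y) \<le> v (x + y)"
  using is_Qp by (simp add: is_Qp_def)

lemma v_rat: "q \<noteq> 0 \<Longrightarrow> v (of_rat q) = padic_val_rat p q"
  using is_Qp by (simp add: is_Qp_def)

lemma complete:
  assumes "\<And>n. \<exists>N. \<forall>i j. N \<le> i \<longrightarrow> N \<le> j \<longrightarrow> vclose v n (s i) (s j)"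
  shows "\<exists>l. \<forall>n. \<exists>N. \<forall>i::nat. N \<le> i \<longrightarrow> vclose v n (s i) l"
  using is_Qp assms unfolding is_Qp_def by blast

lemma rat_dense: "\<exists>q. vclose v n x (of_rat q)"
  using is_Qp by (simp add: is_Qp_def)

lemma v_one: "v 1 = 0"
  using v_mult[of 1 1] by simp

lemma v_uminus: "v (- x) = v x"
proof (cases "x = 0")
  case False
  have "v (- 1) = 0" using v_mult[of "- 1" "- 1"] v_one by simp
  then show ?thesis using v_mult[of "- 1" x] False by simp
qed simp

lemma v_p: "v (of_nat p) = 1"
proof -
  have "p \<noteq> 0" using prime_p by auto
  then have "v (of_nat p) = padic_val_rat p (of_int (int p))"
    using v_rat[of "of_nat p"] by simp
  also have "\<dots> = 1"
    using prime_p by (simp only: padic_val_rat_def quotient_of_int) (auto simp: multiplicity_self)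
  finally show ?thesis .
qed

definition Q :: "int \<Rightarrow> 'k \<Rightarrow> bool" where
  "Q n x \<longleftrightarrow> x = 0 \<or> n \<le> v x"

lemma vclose_iff: "vclose v n x y \<longleftrightarrow> Q n (x - y)"
  by (simp add: vclose_def Q_def)

text \<open>With Q_p as an instance, every fact about filtrations is available on both sides of the
  comparison.\<close>

sublocale padic_filtration p "inverse (of_nat p)" Q
proof -
  have p: "of_nat p \<noteq> (0 :: 'k)" using prime_p by auto
  have diff: "Q n (a - b)" if "Q n a" "Q n b" for n a b
  proof (cases "a = 0 \<or> b = 0 \<or> a = b")
    case False
    then show ?thesis using v_add[of a "- b"] that by (simp add: Q_def v_uminus)
  qed (use that in \<open>auto simp: Q_def v_uminus\<close>)
  show "padic_filtration p (inverse (of_nat p)) Q"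
  proof
    show "Q (n + m) (a * b)" if "Q n a" "Q m b" for n m a b
      using that v_mult[of a b] by (cases "a = 0 \<or> b = 0") (auto simp: Q_def)
    show "\<not> Q (n + m + 1) (a * b)" if "\<not> Q (n + 1) a" "\<not> Q (m + 1) b" for n m a b
      using that v_mult[of a b] by (auto simp: Q_def)
    show "Q (n + 1) (of_nat p * a) \<longleftrightarrow> Q n a" for n a
      using p v_mult[of "of_nat p" a] by (cases "a = 0") (auto simp: Q_def v_p)
  qed (use p prime_p diff in \<open>auto simp: Q_def v_one\<close>)
qed

lemma separated: "(\<And>n. Q n x) \<Longrightarrow> x = 0"
  using Q_def[of "v x + 1" x] by auto

lemma vdvd_iff: "vdvd v x y \<longleftrightarrow> (\<forall>n. Q n x \<longrightarrow> Q n y)"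
proof
  assume *: "\<forall>n. Q n x \<longrightarrow> Q n y"
  show "vdvd v x y"
  proof (cases "x = 0")
    case True
    then have "Q n y" for n using * zero by simp
    then have "y = 0" by (rule separated)
    then show ?thesis by (simp add: vdvd_def)
  next
    case False
    then show ?thesis using spec[OF *, of "v x"] by (auto simp: vdvd_def Q_def)
  qed
qed (auto simp: vdvd_def Q_def)

text \<open>Rationals are dense by assumption. A fraction a/b with b = p^s * b' and b' prime to p is
  close to a*w/p^s, where w inverts b' modulo a high power of p.\<close>

lemma zpow_dense: "\<exists>r. Q n (x - \<rho> r)"
proof -
  obtain q where q: "Q n (x - of_rat q)"
    using rat_dense[of n x] vclose_iff by blast
  obtain a b where ab: "q = of_int a / of_int b" "b \<noteq> 0"
    using quotient_of_div[of q] quotient_of_denom_pos[of q] by (metis less_irrefl surj_pair)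
  obtain b' where b': "b = int p ^ multiplicity (int p) b * b'" "\<not> int p dvd b'"
    using multiplicity_decompose'[of b "int p"] ab(2) prime_p by (metis not_prime_unit prime_nat_int_transfer)
  define s where "s = multiplicity (int p) b"
  \<comment> \<open>The error \<open>y\<close> in 1/b satisfies y * b = 1 - w * b', and b has value
    s; precision n for \<open>y\<close> thus requires precision n + s on the right.\<close>
  define N where "N = nat (n + int s)"
  have "coprime b' (int p ^ N)"
    using b'(2) prime_p by (metis coprime_commute coprime_power_right_iff prime_imp_coprime prime_nat_int_transfer)
  then obtain w t where "w * b' + t * int p ^ N = 1"
    by (metis bezout_int coprime_imp_gcd_eq_1)
  then have w: "int p ^ N dvd 1 - w * b'"
    by (metis add_diff_cancel_left' dvd_triv_right)
  define y :: 'k where "y = 1 / of_int b - of_int w * ppow p (inverse (of_nat p)) (- int s)"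
  have "ppow p (inverse (of_nat p) :: 'k) (- int s) * of_nat p ^ s = 1"
    using ppow_inverse[OF inv_p, of "int s"] by (simp add: ppow_def mult.commute)
  then have wb: "of_int w * ppow p (inverse (of_nat p)) (- int s) * of_int b = (of_int (w * b') :: 'k)"
    by (subst b'(1)) (simp add: s_def[symmetric] ac_simps)
  have "y * of_int b = of_int (1 - w * b')"
    using ab(2) by (simp add: y_def left_diff_distrib wb)
  then have "Q (n + int s) (y * of_int b)"
    using w of_int_iff[of N "1 - w * b'"] antimono[of "int N" _ "n + int s"] by (simp add: N_def)
  moreover have "\<not> int p ^ Suc s dvd int p ^ s * b'"
    using b'(2) prime_p by (simp only: power_Suc2 dvd_mult_cancel_left) auto
  then have "\<not> int p ^ Suc s dvd b"
    using b'(1) by (simp add: s_def)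
  then have "\<not> Q (int s + 1) (of_int b)"
    using of_int_iff[of "Suc s" b] by (simp add: add.commute)
  ultimately have "Q n (of_int a * y)"
    using mult_cancel integral_mult integral_of_int by blast
  moreover have "of_int a * y = of_rat q - \<rho> (a * w, - int s)"
    by (simp add: y_def zpow_def ab of_rat_divide algebra_simps)
  ultimately show ?thesis using diff_trans[OF q] by metis
qed

end

section \<open>Existence and uniqueness of the embedding\<close>

locale padic_embedding =
  A: padic_filtration p i P + K: padic_field p v
  for p i and P :: "int \<Rightarrow> 'a::comm_ring_1 \<Rightarrow> bool" and v :: "'k::field_char_0 \<Rightarrow> int" +
  assumes kochen: "P 0 a \<Longrightarrow> P 1 (a ^ p - a)"
    and bounded: "\<exists>m. P m a"
begin

lemma zpow_transfer: "P n (A.\<rho> r) \<longleftrightarrow> K.Q n (K.\<rho> r)"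
  by (cases r) (simp only: A.zpow_iff K.zpow_iff)

text \<open>The graph of the embedding: $x$ is the limit in ${\bf Q}_p$ of the elements of ${\bf Z}[1/p]$
  approximating $a$.\<close>

definition rel :: "'a \<Rightarrow> 'k \<Rightarrow> bool" where
  "rel a x \<longleftrightarrow> (\<forall>n. \<exists>r. P n (a - A.\<rho> r) \<and> K.Q n (x - K.\<rho> r))"

text \<open>Approximations of a by Z[1/p] are Cauchy in A. Their differences again have codes, with
  the same values in Q_p, so the sequence is Cauchy there and completeness supplies the
  limit.\<close>

lemma rel_exists: "\<exists>x. rel a x"
proof -
  have "\<exists>r. P n (a - A.\<rho> r)" for n
    using bounded[of a] A.approx_zpow[OF kochen] by blast
  then obtain r where r: "\<And>n. P n (a - A.\<rho> (r n))" by metis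
  define s where "s k = K.\<rho> (r (int k))" for k
  have "K.Q n (s k - s l)" if "nat n \<le> k" "nat n \<le> l" for n k l
  proof -
    have "P n (a - A.\<rho> (r (int k)))" "P n (a - A.\<rho> (r (int l)))"
      using that by (auto intro: A.antimono[OF r])
    then have "P n (A.\<rho> (r (int k)) - A.\<rho> (r (int l)))"
      by (metis A.diff_commute A.diff_trans)
    then show ?thesis
      unfolding s_def
      by (simp only: zpow_diff[OF A.inv_p, symmetric] zpow_diff[OF K.inv_p, symmetric] zpow_transfer)
  qed
  then obtain x where x: "\<And>n. \<exists>N. \<forall>k. N \<le> k \<longrightarrow> K.Q n (s k - x)"
    using K.complete[of s] unfolding K.vclose_iff by meson
  have "rel a x" unfolding rel_def
  proof
    fix n
    obtain N where N: "\<And>k. N \<le> k \<Longrightarrow> K.Q n (s k - x)" using x by meson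
    define k where "k = max N (nat n)"
    have "P n (a - A.\<rho> (r (int k)))" by (rule A.antimono[OF r]) (simp add: k_def)
    moreover have "K.Q n (x - K.\<rho> (r (int k)))"
      using N[of k] K.diff_commute by (simp add: k_def s_def)
    ultimately show "\<exists>r. P n (a - A.\<rho> r) \<and> K.Q n (x - K.\<rho> r)" by blast
  qed
  then show ?thesis ..
qed

lemma rel_iff:
  assumes "rel a x"
  shows "P n a \<longleftrightarrow> K.Q n x"
proof -
  obtain r where "P n (a - A.\<rho> r)" "K.Q n (x - K.\<rho> r)" using assms unfolding rel_def by blast
  then show ?thesis using A.cong_iff K.cong_iff zpow_transfer by blast
qed

lemma rel_diff:
  assumes "rel a x" "rel b y"
  shows "rel (a - b) (x - y)"
  unfolding rel_def
proof
  fix n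
  obtain r s where r: "P n (a - A.\<rho> r)" "K.Q n (x - K.\<rho> r)"
    and s: "P n (b - A.\<rho> s)" "K.Q n (y - K.\<rho> s)"
    using assms unfolding rel_def by meson
  have "P n (a - b - A.\<rho> (zpow_diff p r s))"
    using A.diff[OF r(1) s(1)] by (simp add: zpow_diff[OF A.inv_p] algebra_simps)
  moreover have "K.Q n (x - y - K.\<rho> (zpow_diff p r s))"
    using K.diff[OF r(2) s(2)] by (simp only: zpow_diff[OF K.inv_p]) (simp add: algebra_simps)
  ultimately show "\<exists>r. P n (a - b - A.\<rho> r) \<and> K.Q n (x - y - K.\<rho> r)" by blast
qed

lemma rel_mult:
  assumes "rel a x" "rel b y"
  shows "rel (a * b) (x * y)"
  unfolding rel_def
proof
  fix n
  obtain m l where ml: "P m a" "P l b" using bounded by meson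
  then have ml': "K.Q m x" "K.Q l y" using rel_iff assms by blast+
  obtain r s where r: "P (max (n - l) m) (a - A.\<rho> r)" "K.Q (max (n - l) m) (x - K.\<rho> r)"
    and s: "P (n - m) (b - A.\<rho> s)" "K.Q (n - m) (y - K.\<rho> s)"
    using assms unfolding rel_def by meson
  have "P n (a * b - A.\<rho> (zpow_mult r s))"
    unfolding zpow_mult[OF A.inv_p]
    by (rule A.mult_approx[OF ml]) (auto intro: s A.antimono[OF r(1)])
  moreover have "K.Q n (x * y - K.\<rho> (zpow_mult r s))"
    unfolding zpow_mult[OF K.inv_p]
    by (rule K.mult_approx[OF ml']) (auto intro: s K.antimono[OF r(2)])
  ultimately show "\<exists>r. P n (a * b - A.\<rho> r) \<and> K.Q n (x * y - K.\<rho> r)" by blast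
qed

lemma rel_one: "rel 1 1"
  unfolding rel_def by (intro allI exI[of _ "(1, 0)"]) (simp add: zpow_def A.zero K.zero)

lemma rel_add: "rel a x \<Longrightarrow> rel b y \<Longrightarrow> rel (a + b) (x + y)"
  using rel_diff[OF _ rel_diff[OF rel_diff[OF rel_one rel_one]], of a x b y] by simp

lemma rel_unique:
  assumes "rel a x" "rel a y"
  shows "x = y"
proof -
  have "rel 0 (x - y)" using rel_diff[OF assms] by simp
  then have "x - y = 0" using rel_iff A.zero K.separated by blast
  then show ?thesis by simp
qed

lemma ring_hom_zpow:
  assumes "is_ring_hom f"
  shows "f (A.\<rho> r) = K.\<rho> r" and "f (a - b) = f a - f b"
proof -
  have f: "f 1 = 1" "f (a + b) = f a + f b" "f (a * b) = f a * f b" for a b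
    using assms by (auto simp: is_ring_hom_def)
  have f0: "f 0 = 0" using f(2)[of 0 0] by simp
  have diff: "f (a - b) = f a - f b" for a b using f(2)[of "a - b" b] by simp
  then show "f (a - b) = f a - f b" .
  have nat: "f (of_nat n) = of_nat n" for n by (induction n) (simp_all add: f f0)
  have int: "f (of_int z) = of_int z" for z by (cases z rule: int_diff_cases) (simp add: diff nat)
  have pow: "f (a ^ n) = f a ^ n" for a n by (induction n) (simp_all add: f)
  have "f i = inverse (of_nat p)"
    using f(3)[of "of_nat p" i] A.inv_p inverse_unique[of "of_nat p" "f i"] by (simp add: nat f)
  then show "f (A.\<rho> r) = K.\<rho> r"
    by (simp add: zpow_def ppow_def f int pow nat)
qed

text \<open>Divisibility by a power of p is the filtration, and the image of that power under a ring
  homomorphism is forced.\<close>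

lemma filtration_hom_iff:
  assumes "is_ring_hom f" "\<And>a b. (\<forall>n. P n a \<longrightarrow> P n b) \<longleftrightarrow> vdvd v (f a) (f b)"
  shows "P n b \<longleftrightarrow> K.Q n (f b)"
proof -
  have "f (A.\<pi> n) = K.\<pi> n"
    using ring_hom_zpow(1)[OF assms(1), of "(1, n)"] by (simp add: zpow_def)
  then have "(\<forall>m. P m (A.\<pi> n) \<longrightarrow> P m b) \<longleftrightarrow> (\<forall>m. K.Q m (K.\<pi> n) \<longrightarrow> K.Q m (f b))"
    using assms(2)[of "A.\<pi> n" b] by (simp add: K.vdvd_iff)
  then show ?thesis
    unfolding A.ppow_iff K.ppow_iff using A.antimono K.antimono by blast
qed

text \<open>\<open>alpha_hom\<close> is a definite description, so uniqueness matters as much as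
  existence. A competitor fixes Z[1/p] and preserves values, so its graph lies in
  \<open>rel\<close>, which is single-valued.\<close>

lemma embedding_unique_existence:
  "\<exists>!f. is_ring_hom f \<and> (\<forall>a b. (\<forall>n. P n a \<longrightarrow> P n b) \<longleftrightarrow> vdvd v (f a) (f b))"
proof (rule ex_ex1I)
  obtain f where f: "\<And>a. rel a (f a)" using rel_exists by metis
  have "is_ring_hom f" unfolding is_ring_hom_def
    using rel_unique[OF f] rel_one rel_add[OF f f] rel_mult[OF f f] by blast
  then show "\<exists>f. is_ring_hom f \<and> (\<forall>a b. (\<forall>n. P n a \<longrightarrow> P n b) \<longleftrightarrow> vdvd v (f a) (f b))"
    using rel_iff[OF f] by (auto simp: K.vdvd_iff)
next
  have rel: "rel a (f a)"
    if hom: "is_ring_hom f" and f: "\<And>a b. (\<forall>n. P n a \<longrightarrow> P n b) \<longleftrightarrow> vdvd v (f a) (f b)" for f a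
  proof -
    have "\<exists>r. P n (a - A.\<rho> r)" for n
      using bounded[of a] A.approx_zpow[OF kochen] by blast
    then show ?thesis
      unfolding rel_def filtration_hom_iff[OF hom f] ring_hom_zpow[OF hom] by blast
  qed
  fix f g
  assume "is_ring_hom f \<and> (\<forall>a b. (\<forall>n. P n a \<longrightarrow> P n b) \<longleftrightarrow> vdvd v (f a) (f b))"
    and "is_ring_hom g \<and> (\<forall>a b. (\<forall>n. P n a \<longrightarrow> P n b) \<longleftrightarrow> vdvd v (g a) (g b))"
  then show "f = g" using rel rel_unique by blast
qed

end

subsection \<open>Compactness of the spectrum\<close>

context padic_filtration
begin

text \<open>In u^p - 1 = (u - 1) * (1 + u + ... + u^(p-1)) every summand of the second factor is 1
  modulo p. That factor is therefore p = 0 modulo p, which gains one level.\<close>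

lemma pth_power_one_unit:
  assumes u: "P (int (Suc j)) (u - 1)"
  shows "P (int (Suc (Suc j))) (u ^ p - 1)"
proof -
  have u1: "P 1 (u - 1)" using antimono[OF u] by simp
  have "P 0 u" using add[OF antimono[OF u1] one] by simp
  have sum: "P n (\<Sum>k\<in>A. f k)" if "\<And>k. P n (f k)" for n f and A :: "nat set"
    by (induction A rule: infinite_finite_induct) (auto simp: zero add that)
  have "P 1 (u ^ k - 1)" for k
    using mult[OF u1 sum[OF integral_power[OF \<open>P 0 u\<close>], where A = "{..<k}"]]
    by (simp add: power_diff_1_eq)
  then have "P 1 (\<Sum>k<p. u ^ k - 1)" by (rule sum)
  then have "P 1 ((\<Sum>k<p. u ^ k) - of_nat p)" by (simp add: sum_subtractf)
  moreover have "P 1 (of_nat p)" using ppow_iff[of 1 1] by simp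
  ultimately have "P 1 (\<Sum>k<p. u ^ k)" using cong_iff by blast
  from mult[OF u this] show ?thesis by (simp add: power_diff_1_eq add.commute)
qed

text \<open>The powers $a^{(p-1)p^N}$ converge to the indicator function of the set where $a$ is a unit.\<close>

lemma unit_power_near_one:
  assumes "P 0 a" "P 1 (a ^ p - a)" "\<not> P 1 a"
  shows "P (int N) (a ^ ((p - 1) * p ^ N) - 1)"
proof -
  \<comment> \<open>The induction runs one level above the claim: it starts from a^(p-1) = 1 modulo
    p, and a p-th power gains a level only from level 1 on.\<close>
  have "P (int (Suc N)) ((a ^ (p - 1)) ^ (p ^ N) - 1)"
  proof (induction N)
    case 0
    have "a ^ p = a * a ^ (p - 1)" using prime_gt_0_nat[OF prime_p] by (cases p) auto
    then have "P 1 (a * (a ^ (p - 1) - 1))" using assms(2) by (simp add: right_diff_distrib)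
    then show ?case using prime_mult assms(3) by auto
  next
    case (Suc N)
    from pth_power_one_unit[OF this] show ?case
      by (simp only: power_mult[symmetric] power_Suc2 mult.assoc)
  qed
  then show ?thesis by (auto simp: power_mult intro: antimono)
qed

lemma nonunit_power_near_zero:
  assumes "P 1 a"
  shows "P (int N) (a ^ ((p - 1) * p ^ N))"
proof -
  have p: "2 \<le> p" using prime_p prime_ge_2_nat by blast
  then have "N \<le> p ^ N" by (metis less_exp less_imp_le_nat order_trans power_mono zero_le)
  also have "\<dots> \<le> (p - 1) * p ^ N" using p by simp
  finally show ?thesis by (intro antimono[OF power_ge[OF assms]]) (simp only: of_nat_le_iff)
qed

end

context archimedean_pdivisibility
begin

abbreviation "X \<equiv> Spec_max_Dp p d0"

lemma Spec_max_Spec: "x \<in> X \<Longrightarrow> x \<in> Spec_Dp p d0"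
  by (simp add: Spec_max_Dp_def)

lemma filtration_max: "x \<in> X \<Longrightarrow> padic_filtration p i (\<lambda>n. x (\<pi> n))"
  by (rule filtration[OF Spec_max_Spec])

text \<open>The bound already holds for \<open>d0\<close>, which every point contains; hence one m
  serves all of X.\<close>

lemma uniform_bound: "\<exists>m. \<forall>x\<in>X. x (\<pi> m) a"
  using lower_bound[of a] contains[OF Spec_max_Spec] by auto

lemma kochen_max: "x \<in> X \<Longrightarrow> x (\<pi> 0) a \<Longrightarrow> x (\<pi> 1) (a ^ p - a)"
  using kochen[OF Spec_max_Spec] by simp

lemma topspace_spec_top: "topspace (spec_top X) = X"
  by (auto simp: spec_top_def)

lemma openin_basic: "openin (spec_top X) {x \<in> X. \<not> x a b}"
  unfolding spec_top_def by (intro topology_generated_by_Basis) blast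

lemma openin_ge: "openin (spec_top X) {x \<in> X. x (\<pi> n) a}"
proof -
  have "{x \<in> X. x (\<pi> n) a} = {x \<in> X. \<not> x a (\<pi> (n - 1))}"
    using discrete_iff[OF Spec_max_Spec, of _ "n - 1" a] by auto
  then show ?thesis by (simp add: openin_basic)
qed

text \<open>Divisibilities correspond to filtrations, whose axioms involve finitely many values each;
  so they form a closed subset of a power of the two-point space.\<close>

lemma compact_spec: "compact_space (spec_top X)"
proof -
  define T where "T = product_topology (\<lambda>_ :: int \<times> 'a. discrete_topology (UNIV :: bool set)) UNIV"
  define Y where "Y = {P :: int \<times> 'a \<Rightarrow> bool. padic_filtration p i (\<lambda>n a. P (n, a)) \<and>
    (\<forall>n a b. d0 a b \<longrightarrow> P (n, a) \<longrightarrow> P (n, b))}"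
  define F where "F P = (\<lambda>a b. \<forall>n. P (n, a) \<longrightarrow> P (n, b))" for P :: "int \<times> 'a \<Rightarrow> bool"
  have T: "topspace T = UNIV" by (simp add: T_def)
  have cont: "continuous_map T (discrete_topology UNIV) (\<lambda>P. P k)" for k
    unfolding T_def by (rule continuous_map_product_projection) simp
  have op: "openin T {P. P k}" "openin T {P. \<not> P k}" for k
    using openin_continuous_map_preimage[OF cont, of "{True}" k]
      openin_continuous_map_preimage[OF cont, of "{False}" k] by (simp_all add: T)
  \<comment> \<open>Atoms and their negations are both closed, so closedness of each axiom can be
    read off from its syntax.\<close>
  have cl: "closedin T {P. P k}" "closedin T {P. \<not> P k}" for k
    using closedin_continuous_map_preimage[OF cont, of "{True}" k]
      closedin_continuous_map_preimage[OF cont, of "{False}" k] by (simp_all add: T)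
  have cl_const: "closedin T {P. c}" for c
    using closedin_topspace[of T] closedin_empty[of T] by (cases c) (simp_all add: T)
  have cl_all: "closedin T {P. \<forall>j. A j P}" if "\<And>j. closedin T {P. A j P}"
    for A :: "'j \<Rightarrow> (int \<times> 'a \<Rightarrow> bool) \<Rightarrow> bool"
  proof -
    have "{P. \<forall>j. A j P} = (\<Inter>j. {P. A j P})" by auto
    then show ?thesis using that by (simp add: closedin_INT)
  qed
  have cl_conj: "closedin T {P. A P \<and> B P}" if "closedin T {P. A P}" "closedin T {P. B P}" for A B
    using closedin_Int[OF that] by (simp add: Collect_conj_eq)
  have cl_imp: "closedin T {P. A P \<longrightarrow> B P}" if "closedin T {P. \<not> A P}" "closedin T {P. B P}" for A B
  proof -
    have "{P. A P \<longrightarrow> B P} = {P. \<not> A P} \<union> {P. B P}" by auto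
    then show ?thesis using closedin_Un[OF that] by simp
  qed
  \<comment> \<open>For \<open>mult_less\<close>, whose premises are themselves negated.\<close>
  have cl_nn: "closedin T {P. \<not> \<not> A P}" if "closedin T {P. A P}" for A
    using that by simp
  have "closedin T Y"
    unfolding Y_def padic_filtration_def iff_conv_conj_imp
    by (intro cl_all cl_conj cl_imp cl_nn cl_const cl)
  then have compact: "compactin T Y"
    by (intro closedin_compact_space) (auto simp: T_def compact_space_product_topology compact_space_discrete_topology)
  have FX: "F P \<in> X" if "P \<in> Y" for P
    using that filtration_in_Spec_max(1)[of "\<lambda>n a. P (n, a)"] by (auto simp: Y_def F_def)
  \<comment> \<open>A failure of divisibility under \<open>F P\<close> is witnessed at a single
    level n, so the preimage of a subbasic set is a union of open sets.\<close>
  have "continuous_map (subtopology T Y) (spec_top X) F"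
    unfolding spec_top_def
  proof (rule continuous_on_generated_topo)
    fix U assume U: "U \<in> insert X {{d \<in> X. \<not> d a b} | a b. True}"
    show "openin (subtopology T Y) (F -` U \<inter> topspace (subtopology T Y))"
    proof (cases "U = X")
      case True
      then have "F -` U \<inter> topspace (subtopology T Y) = topspace (subtopology T Y)"
        using FX by (auto simp: T)
      then show ?thesis using openin_topspace by metis
    next
      case False
      then obtain a b where "U = {d \<in> X. \<not> d a b}" using U by blast
      then have "F -` U \<inter> topspace (subtopology T Y)
          = (\<Union>n. {P. P (n, a)} \<inter> {P. \<not> P (n, b)}) \<inter> Y"
        using FX by (auto simp: T F_def)
      then show ?thesis
        by (simp only:) (intro openin_subtopology_Int openin_Union, auto intro: op)
    qed
  qed (use FX in \<open>auto simp: T\<close>)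
  then have "compactin (spec_top X) (F ` Y)"
    using compact by (intro image_compactin) (auto simp: compactin_subtopology)
  moreover have "X \<subseteq> F ` Y"
  proof
    fix x assume x: "x \<in> X"
    have "x = F (\<lambda>(n, a). x (\<pi> n) a)"
      unfolding F_def prod.case by (intro ext) (rule divides_iff_filtration[OF x])
    moreover have "(\<lambda>(n, a). x (\<pi> n) a) \<in> Y"
      using filtration_max[OF x]
      by (auto simp: Y_def intro: trans[OF Spec_max_Spec[OF x] _ contains[OF Spec_max_Spec[OF x]]])
    ultimately show "x \<in> F ` Y" by blast
  qed
  then have "X = F ` Y" using FX by blast
  ultimately show ?thesis unfolding compact_space_def topspace_spec_top by metis
qed

end

subsection \<open>Uniform approximation\<close>

context archimedean_pdivisibility
begin

text \<open>Closeness to the indicator function of S is measured by the divisibilities themselves,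
  so that indicators are handled inside A.\<close>

definition approximates :: "'a \<Rightarrow> ('a \<Rightarrow> 'a \<Rightarrow> bool) set \<Rightarrow> int \<Rightarrow> bool" where
  "approximates e S N \<longleftrightarrow>
     (\<forall>x\<in>X. (x \<in> S \<longrightarrow> x (\<pi> N) (e - 1)) \<and> (x \<notin> S \<longrightarrow> x (\<pi> N) e))"

definition approximable :: "('a \<Rightarrow> 'a \<Rightarrow> bool) set \<Rightarrow> bool" where
  "approximable S \<longleftrightarrow> (\<forall>N. \<exists>e. approximates e S N)"

lemma approximatesD:
  assumes "approximates e S N" "x \<in> X"
  shows "x \<in> S \<Longrightarrow> x (\<pi> N) (e - 1)" and "x \<notin> S \<Longrightarrow> x (\<pi> N) e"
  using bspec[OF assms(1)[unfolded approximates_def] assms(2)] by simp_all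

lemma approximable_cong:
  assumes "S \<inter> X = S' \<inter> X"
  shows "approximable S \<longleftrightarrow> approximable S'"
proof -
  have "x \<in> S \<longleftrightarrow> x \<in> S'" if "x \<in> X" for x using assms that by blast
  then show ?thesis by (simp add: approximable_def approximates_def cong: ball_cong)
qed

lemma approximable_UNIV: "approximable UNIV"
  unfolding approximable_def approximates_def
proof (intro allI exI[of _ 1] ballI conjI impI)
  show "x (\<pi> N) (1 - 1)" if "x \<in> X" for x N
    using zero[OF Spec_max_Spec[OF that]] by simp
qed simp

lemma approximable_Compl:
  assumes "approximable S"
  shows "approximable (- S)"
  unfolding approximable_def
proof
  fix N
  obtain e where e: "approximates e S N" using assms unfolding approximable_def by blast
  have "approximates (1 - e) (- S) N"
    unfolding approximates_def
  proof
    fix x assume x: "x \<in> X"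
    show "(x \<in> - S \<longrightarrow> x (\<pi> N) (1 - e - 1)) \<and> (x \<notin> - S \<longrightarrow> x (\<pi> N) (1 - e))"
      using uminus[OF Spec_max_Spec[OF x] approximatesD(2)[OF e x]] uminus[OF Spec_max_Spec[OF x] approximatesD(1)[OF e x]]
      by simp
  qed
  then show "\<exists>e. approximates e (- S) N" ..
qed

lemma approximable_Int:
  assumes "approximable S" "approximable S'"
  shows "approximable (S \<inter> S')"
  unfolding approximable_def
proof
  fix N :: int
  \<comment> \<open>Precision at least 0 makes both approximants integral, so multiplication by
    either does not enlarge an error.\<close>
  define M where "M = max N 0"
  obtain e where e: "approximates e S M" using assms(1) unfolding approximable_def by blast
  obtain f where f: "approximates f S' M" using assms(2) unfolding approximable_def by blast
  have "approximates (e * f) (S \<inter> S') N"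
    unfolding approximates_def
  proof
    fix x assume x: "x \<in> X"
    interpret F: padic_filtration p i "\<lambda>n. x (\<pi> n)" by (rule filtration_max[OF x])
    have int: "x (\<pi> 0) c" if "x (\<pi> M) (c - 1) \<or> x (\<pi> M) c" for c
    proof -
      have "x (\<pi> 0) (c - 1) \<or> x (\<pi> 0) c" using that F.antimono[of M "c - 1" 0] F.antimono[of M c 0] by (auto simp: M_def)
      then show ?thesis using F.add[of 0 "c - 1" 1] F.one by auto
    qed
    have ef: "x (\<pi> 0) e" "x (\<pi> 0) f"
      using int[of e] int[of f] approximatesD[OF e x] approximatesD[OF f x] by blast+
    have le: "x (\<pi> N) c" if "x (\<pi> M) c" for c by (rule F.antimono[OF that]) (simp add: M_def)
    consider "x \<in> S" "x \<in> S'" | "x \<notin> S" | "x \<notin> S'" by blast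
    then show "(x \<in> S \<inter> S' \<longrightarrow> x (\<pi> N) (e * f - 1)) \<and> (x \<notin> S \<inter> S' \<longrightarrow> x (\<pi> N) (e * f))"
    proof cases
      case 1
      have "x (\<pi> M) (f * (e - 1) + (f - 1))"
        by (intro F.add F.integral_mult ef approximatesD(1)[OF e x] approximatesD(1)[OF f x] 1)
      then show ?thesis using 1 le[of "e * f - 1"] by (simp add: algebra_simps)
    next
      case 2
      then show ?thesis using F.integral_mult[OF ef(2) approximatesD(2)[OF e x 2]] 2 le[of "e * f"] by (simp add: mult.commute)
    next
      case 3
      then show ?thesis using F.integral_mult[OF ef(1) approximatesD(2)[OF f x 3]] 3 le[of "e * f"] by simp
    qed
  qed
  then show "\<exists>e. approximates e (S \<inter> S') N" ..
qed

lemma approximable_nonunit: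
  assumes "\<And>x. x \<in> X \<Longrightarrow> x (\<pi> 0) a"
  shows "approximable {x. x (\<pi> 1) a}"
proof -
  have "approximable (- {x. x (\<pi> 1) a})"
    unfolding approximable_def approximates_def
  proof (intro allI exI ballI)
    fix N x assume x: "x \<in> X"
    interpret F: padic_filtration p i "\<lambda>n. x (\<pi> n)" by (rule filtration_max[OF x])
    let ?e = "a ^ ((p - 1) * p ^ nat N)"
    have N: "N \<le> int (nat N)" by simp
    have "\<not> x (\<pi> 1) a \<Longrightarrow> x (\<pi> N) (?e - 1)"
      by (intro F.antimono[OF _ N] F.unit_power_near_one kochen_max[OF x] assms[OF x])
    moreover have "x (\<pi> 1) a \<Longrightarrow> x (\<pi> N) ?e"
      by (intro F.antimono[OF _ N] F.nonunit_power_near_zero)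
    ultimately show "(x \<in> - {x. x (\<pi> 1) a} \<longrightarrow> x (\<pi> N) (?e - 1)) \<and> (x \<notin> - {x. x (\<pi> 1) a} \<longrightarrow> x (\<pi> N) ?e)"
      unfolding Compl_iff mem_Collect_eq by blast
  qed
  from approximable_Compl[OF this] show ?thesis by simp
qed

text \<open>\<open>approximable_nonunit\<close> requires an element integral at every point, while a
  divided by p^(m+j) is integral only where v(a) is at least m + j. Multiplying by an approximate
  indicator e of that set repairs this: the quotient becomes integral everywhere, and on the set its
  positivity still tests the next level.\<close>

lemma approximable_ge: "approximable {x. x (\<pi> n) a}"
proof -
  obtain m where m: "\<And>x. x \<in> X \<Longrightarrow> x (\<pi> m) a" using uniform_bound by blast
  have "approximable {x. x (\<pi> (m + int j)) a}" for j
  proof (induction j)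
    case 0
    have "{x. x (\<pi> (m + int 0)) a} \<inter> X = UNIV \<inter> X" using m by auto
    then show ?case using approximable_UNIV approximable_cong by blast
  next
    case (Suc j)
    let ?S = "{x. x (\<pi> (m + int j)) a}"
    \<comment> \<open>Since a has value at least m everywhere, an error of value j + 1 in e becomes
      one of value m + j + 1 in \<open>e * a\<close>, just enough to test level m + j + 1.\<close>
    obtain e where e: "approximates e ?S (int j + 1)" using Suc unfolding approximable_def by blast
    define b where "b = \<pi> (- (m + int j)) * (e * a)"
    have shift: "x (\<pi> k) b \<longleftrightarrow> x (\<pi> (k + (m + int j))) (e * a)" if "x \<in> X" for x k
      unfolding b_def padic_filtration.ppow_mult[OF filtration_max[OF that]] diff_minus_eq_add ..
    have near: "x (\<pi> (m + int (Suc j))) (e * a - a)" if "x \<in> X" "x \<in> ?S" for x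
      using \<pi>_mult[OF Spec_max_Spec[OF that(1)] approximatesD(1)[OF e that] m[OF that(1)]]
      by (simp add: algebra_simps)
    have "x (\<pi> 0) b" if x: "x \<in> X" for x
    proof -
      interpret F: padic_filtration p i "\<lambda>n. x (\<pi> n)" by (rule filtration_max[OF x])
      have "x (\<pi> (m + int j)) (e * a)"
      proof (cases "x \<in> ?S")
        case True
        then show ?thesis using F.cong_iff[of "m + int j" "e * a" a] F.antimono[OF near[OF x True], of "m + int j"] by simp
      next
        case False
        then show ?thesis
          by (intro F.antimono[OF \<pi>_mult[OF Spec_max_Spec[OF x] approximatesD(2)[OF e x False] m[OF x]]]) simp
      qed
      then show ?thesis unfolding shift[OF x] by simp
    qed
    then have "approximable (?S \<inter> {x. x (\<pi> 1) b})"
      by (intro approximable_Int Suc approximable_nonunit)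
    moreover have "?S \<inter> {x. x (\<pi> 1) b} \<inter> X = {x. x (\<pi> (m + int (Suc j))) a} \<inter> X"
    proof -
      have "x \<in> ?S \<and> x (\<pi> 1) b \<longleftrightarrow> x (\<pi> (m + int (Suc j))) a" if x: "x \<in> X" for x
      proof -
        interpret F: padic_filtration p i "\<lambda>n. x (\<pi> n)" by (rule filtration_max[OF x])
        have "x (\<pi> (m + int (Suc j))) a \<Longrightarrow> x \<in> ?S"
          using F.antimono[of "m + int (Suc j)" a "m + int j"] by simp
        moreover have "x \<in> ?S \<Longrightarrow> x (\<pi> 1) b \<longleftrightarrow> x (\<pi> (m + int (Suc j))) a"
          using F.cong_iff[OF near[OF x]] shift[OF x, of 1] by (simp add: algebra_simps)
        ultimately show ?thesis by blast
      qed
      then show ?thesis by blast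
    qed
    ultimately show ?case using approximable_cong by blast
  qed
  from this[of "nat (n - m)"] show ?thesis
  proof (cases "m \<le> n")
    case False
    have "x (\<pi> n) a" if "x \<in> X" for x
      using padic_filtration.antimono[OF filtration_max[OF that] m[OF that]] False by simp
    then have "{x. x (\<pi> n) a} \<inter> X = UNIV \<inter> X" by auto
    then show ?thesis using approximable_UNIV approximable_cong by blast
  qed simp
qed

text \<open>Induction over the generation of the topology. If a does not divide b at x, some level n
  satisfies v(a) >= n > v(b) there, and this inequality cuts out an open approximable set on which a
  never divides b.\<close>

lemma approximable_nhds:
  assumes "openin (spec_top X) V" "x \<in> V"
  shows "\<exists>S. x \<in> S \<and> S \<subseteq> V \<and> openin (spec_top X) S \<and> approximable S"
  using openin_topology_generated_by[OF assms(1)[unfolded spec_top_def]] assms(2)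
proof (induction arbitrary: x rule: generate_topology_on.induct)
  case (Int U W)
  have "x \<in> U" "x \<in> W" using Int.prems by simp_all
  obtain S where S: "x \<in> S \<and> S \<subseteq> U \<and> openin (spec_top X) S \<and> approximable S"
    using Int.IH(1)[OF \<open>x \<in> U\<close>] ..
  obtain S' where S': "x \<in> S' \<and> S' \<subseteq> W \<and> openin (spec_top X) S' \<and> approximable S'"
    using Int.IH(2)[OF \<open>x \<in> W\<close>] ..
  have "openin (spec_top X) (S \<inter> S')" "approximable (S \<inter> S')"
    using S S' by (simp_all add: openin_Int approximable_Int)
  moreover have "S \<inter> S' \<subseteq> U \<inter> W" using S S' by auto
  ultimately show ?case using S S' by (intro exI[of _ "S \<inter> S'"]) simp
next
  case (UN K)
  then obtain U where U: "U \<in> K" "x \<in> U" by auto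
  obtain S where "x \<in> S \<and> S \<subseteq> U \<and> openin (spec_top X) S \<and> approximable S"
    using UN.IH[OF U] ..
  then show ?case using U(1) by (intro exI[of _ S]) auto
next
  case (Basis U)
  consider "U = X" | a b where "U = {d \<in> X. \<not> d a b}" using Basis(1) by blast
  then show ?case
  proof cases
    case 1
    moreover have "openin (spec_top X) X" using openin_topspace[of "spec_top X"] by (simp add: topspace_spec_top)
    moreover have "approximable X" using approximable_UNIV approximable_cong[of X UNIV] by simp
    ultimately show ?thesis using Basis(2) by (intro exI[of _ X]) simp
  next
    case 2
    then have x: "x \<in> X" "\<not> x a b" using Basis(2) by auto
    then obtain n where n: "x (\<pi> n) a" "\<not> x (\<pi> n) b"
      using divides_iff_filtration[OF x(1), of a b] by auto
    define S where "S = {x \<in> X. x (\<pi> n) a} \<inter> {x \<in> X. \<not> x (\<pi> n) b}"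
    have "S \<inter> X = {x. x (\<pi> n) a} \<inter> - {x. x (\<pi> n) b} \<inter> X" by (auto simp: S_def)
    from approximable_cong[OF this] have "approximable S"
      by (simp add: approximable_Int approximable_ge approximable_Compl)
    moreover have "openin (spec_top X) S"
      unfolding S_def by (intro openin_Int openin_ge openin_basic)
    moreover have "S \<subseteq> U"
    proof
      fix y assume "y \<in> S"
      then have y: "y \<in> X" "y (\<pi> n) a" "\<not> y (\<pi> n) b" by (simp_all add: S_def)
      then show "y \<in> U" using trans[OF Spec_max_Spec[OF y(1)] y(2), of b] by (auto simp: 2)
    qed
    moreover have "x \<in> S" using x n by (simp add: S_def)
    ultimately show ?thesis by (intro exI[of _ S]) simp
  qed
qed simp

end

section \<open>The functions \<open>hat v a\<close>: continuity and density\<close>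

locale padic_representation =
  archimedean_pdivisibility p i d0 + K: padic_field p v
  for p i and d0 :: "'a::comm_ring_1 \<Rightarrow> 'a \<Rightarrow> bool" and v :: "'k::field_char_0 \<Rightarrow> int"
begin

lemma embedding:
  assumes x: "x \<in> X"
  shows "padic_embedding p i (\<lambda>n. x (\<pi> n)) v"
proof (intro padic_embedding.intro padic_embedding_axioms.intro)
  show "padic_filtration p i (\<lambda>n. x (\<pi> n))" by (rule filtration_max[OF x])
  show "padic_field p v" by (rule K.padic_field_axioms)
  show "x (\<pi> 1) (a ^ p - a)" if "x (\<pi> 0) a" for a by (rule kochen_max[OF x that])
  show "\<exists>m. x (\<pi> m) a" for a
  proof -
    obtain m where "d0 (\<pi> m) a" using lower_bound ..
    from contains[OF Spec_max_Spec[OF x] this] show ?thesis ..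
  qed
qed

lemma hat_properties:
  assumes x: "x \<in> X"
  shows "is_ring_hom (\<lambda>a. hat v a x)" and "x a b \<longleftrightarrow> vdvd v (hat v a x) (hat v b x)"
proof -
  interpret E: padic_embedding p i "\<lambda>n. x (\<pi> n)" v by (rule embedding[OF x])
  have "\<exists>!f. is_ring_hom f \<and> (\<forall>a b. x a b \<longleftrightarrow> vdvd v (f a) (f b))"
    using E.embedding_unique_existence
    by (simp only: divides_iff_filtration[OF x, symmetric])
  from theI'[OF this, folded alpha_hom_def]
  have hom: "is_ring_hom (alpha_hom v x)" "\<forall>a b. x a b \<longleftrightarrow> vdvd v (alpha_hom v x a) (alpha_hom v x b)"
    by (rule conjunct1, rule conjunct2)
  show "is_ring_hom (\<lambda>a. hat v a x)" unfolding hat_def by (rule hom(1))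
  show "x a b \<longleftrightarrow> vdvd v (hat v a x) (hat v b x)" unfolding hat_def by (rule hom(2)[rule_format])
qed

lemma hat_filtration:
  assumes x: "x \<in> X"
  shows "x (\<pi> n) a \<longleftrightarrow> K.Q n (hat v a x)"
proof -
  interpret E: padic_embedding p i "\<lambda>n. x (\<pi> n)" v by (rule embedding[OF x])
  show ?thesis
    by (rule E.filtration_hom_iff[OF hat_properties(1)[OF x]])
      (rule HOL.trans[OF divides_iff_filtration[OF x, symmetric] hat_properties(2)[OF x]])
qed

lemma hat_zpow_diff:
  assumes x: "x \<in> X"
  shows "hat v (a - \<rho> r) x = hat v a x - K.\<rho> r"
proof -
  interpret E: padic_embedding p i "\<lambda>n. x (\<pi> n)" v by (rule embedding[OF x])
  show ?thesis by (simp only: E.ring_hom_zpow[OF hat_properties(1)[OF x]])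
qed

text \<open>By the ultrametric inequality, a ball may be recentred at an element of Z[1/p]. Its
  preimage is then a filtration condition on a translate of a, which is open.\<close>

lemma continuous_hat: "continuous_map (spec_top X) (Qp_top v) (hat v a)"
  unfolding Qp_top_def
proof (rule continuous_on_generated_topo)
  fix U assume "U \<in> {{y. vclose v n c y} | c n. True}"
  then obtain c n where U: "U = {y. K.Q n (c - y)}" by (auto simp: K.vclose_iff)
  obtain r where r: "K.Q n (c - K.\<rho> r)" using K.zpow_dense by blast
  have "K.Q n (c - hat v a x) \<longleftrightarrow> x (\<pi> n) (a - \<rho> r)" if "x \<in> X" for x
    unfolding hat_filtration[OF that] hat_zpow_diff[OF that] by (rule K.diff_cong[OF r])
  then have "hat v a -` U \<inter> topspace (spec_top X) = {x \<in> X. x (\<pi> n) (a - \<rho> r)}"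
    by (auto simp: U topspace_spec_top)
  then show "openin (spec_top X) (hat v a -` U \<inter> topspace (spec_top X))"
    by (simp add: openin_ge)
next
  have "vclose v 0 y y" for y by (simp add: vclose_def)
  then show "hat v a ` topspace (spec_top X) \<subseteq> \<Union> {{y. vclose v n c y} | c n. True}" by blast
qed

text \<open>The sets of the finite cover may overlap. They are absorbed one at a time: adding e * (r
  - a) to a overwrites its value by r on the new set and preserves it elsewhere up to the error, so
  no partition into disjoint pieces is required.\<close>

lemma dense_hat:
  assumes f: "continuous_map (spec_top X) (Qp_top v) f"
  shows "\<exists>a. \<forall>x\<in>X. K.Q N (f x - hat v a x)"
proof -
  define V where "V r = {x \<in> X. K.Q N (f x - K.\<rho> r)}" for r
  have "openin (Qp_top v) {y. vclose v N c y}" for c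
    unfolding Qp_top_def by (intro topology_generated_by_Basis) blast
  from openin_continuous_map_preimage[OF f this[of "K.\<rho> _"]]
  have V: "openin (spec_top X) (V r)" for r
    by (simp add: V_def K.vclose_iff topspace_spec_top K.diff_commute[of N "K.\<rho> _"])
  define \<U> where "\<U> = {S. openin (spec_top X) S \<and> approximable S \<and> (\<exists>r. S \<subseteq> V r)}"
  have cover: "X \<subseteq> \<Union>\<U>"
  proof
    fix x assume "x \<in> X"
    then obtain r where "x \<in> V r" using K.zpow_dense[of N "f x"] by (auto simp: V_def)
    from approximable_nhds[OF V this] show "x \<in> \<Union>\<U>" unfolding \<U>_def by blast
  qed
  have "\<forall>U\<in>\<U>. openin (spec_top X) U" by (simp add: \<U>_def)
  with cover obtain \<F> where \<F>: "finite \<F>" "\<F> \<subseteq> \<U>" "X \<subseteq> \<Union>\<F>"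
    using compact_spec[unfolded compact_space_alt topspace_spec_top, THEN spec, of \<U>] by blast
  \<comment> \<open>Comparison through a common r in Z[1/p] states closeness to f x by means of the
    divisibility at x; \<open>hat\<close> returns only at the end.\<close>
  define near where "near x a \<longleftrightarrow> (\<exists>r. K.Q N (f x - K.\<rho> r) \<and> x (\<pi> N) (a - \<rho> r))" for x a
  have "\<exists>a. \<forall>x\<in>X \<inter> \<Union>\<F>. near x a"
    using \<F>(1,2)
  proof (induction \<F> rule: finite_induct)
    case (insert S \<F>)
    then obtain a where a: "\<forall>x\<in>X \<inter> \<Union>\<F>. near x a" by auto
    obtain r where r: "S \<subseteq> V r" and S: "approximable S" using insert.prems by (auto simp: \<U>_def)
    \<comment> \<open>The correction has value at least m on all of X, so precision N - m for e
      leaves an error of value at least N.\<close>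
    obtain m where m: "\<forall>x\<in>X. x (\<pi> m) (\<rho> r - a)" using uniform_bound ..
    obtain e where e: "approximates e S (N - m)" using S unfolding approximable_def by blast
    define b where "b = a + e * (\<rho> r - a)"
    have "near x b" if x: "x \<in> X" "x \<in> \<Union>(insert S \<F>)" for x
    proof -
      interpret F: padic_filtration p i "\<lambda>n. x (\<pi> n)" by (rule filtration_max[OF x(1)])
      show ?thesis
      proof (cases "x \<in> S")
        case True
        then have "x (\<pi> N) ((e - 1) * (\<rho> r - a))"
          using F.mult[OF approximatesD(1)[OF e x(1) True] bspec[OF m x(1)]] by simp
        then have "x (\<pi> N) (b - \<rho> r)" by (simp add: b_def algebra_simps)
        moreover have "K.Q N (f x - K.\<rho> r)" using True r by (auto simp: V_def)
        ultimately show ?thesis unfolding near_def by blast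
      next
        case False
        then have "x (\<pi> N) (b - a)"
          using F.mult[OF approximatesD(2)[OF e x(1) False] bspec[OF m x(1)]] by (simp add: b_def)
        moreover have "near x a" using a x False by auto
        ultimately show ?thesis unfolding near_def using F.diff_trans[of N b a] by blast
      qed
    qed
    then show ?case by (intro exI[of _ b]) simp
  qed simp
  then obtain a where a: "\<forall>x\<in>X. near x a" using \<F>(3) by blast
  have "K.Q N (f x - hat v a x)" if x: "x \<in> X" for x
  proof -
    obtain r where "K.Q N (f x - K.\<rho> r)" "K.Q N (hat v a x - K.\<rho> r)"
      using bspec[OF a x] unfolding near_def hat_filtration[OF x] hat_zpow_diff[OF x] by blast
    then show ?thesis using K.diff_cong by blast
  qed
  then show ?thesis by blast
qed

lemma pabs_le:
  assumes "\<epsilon> > 0"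
  shows "\<exists>N. \<forall>x. K.Q N x \<longrightarrow> pabs p v x \<le> \<epsilon>"
proof -
  have p: "1 < real p" using prime_p prime_gt_1_nat by simp
  then obtain n where n: "inverse (real p) ^ n < \<epsilon>"
    using real_arch_pow_inv[OF assms, of "inverse (real p)"] by (auto simp: inverse_less_1_iff)
  have "pabs p v x \<le> \<epsilon>" if "K.Q (int n) x" for x
  proof (cases "x = 0")
    case False
    then have "int n \<le> v x" using that by (simp add: K.Q_def)
    then have "real p powr (- real_of_int (v x)) \<le> real p powr (- real n)"
      using p by (intro powr_mono) auto
    also have "\<dots> = inverse (real p) ^ n"
      using p by (simp add: powr_minus powr_realpow power_inverse)
    finally show ?thesis using n False by (simp add: pabs_def)
  qed (use assms in \<open>simp add: pabs_def\<close>)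
  then show ?thesis by blast
qed

end

theorem theorem4p1:
  fixes p :: nat
    and d0 :: "'a::comm_ring_1 \<Rightarrow> 'a \<Rightarrow> bool"
    and v :: "'k::field_char_0 \<Rightarrow> int"
    and X :: "('a \<Rightarrow> 'a \<Rightarrow> bool) set"
  assumes "prime p"
    and "\<forall>n::nat. 0 < n \<longrightarrow> (\<exists>b::'a. of_nat n * b = 1)"
    and "is_pdivisibility p d0"
    and "p_archimedean p d0"
    and "is_Qp p v"
    and "X = Spec_max_Dp p d0"
  shows "(\<forall>a. continuous_map (spec_top X) (Qp_top v) (hat v a))
       \<and> (\<forall>x\<in>X. hat v 1 x = 1)
       \<and> (\<forall>a b. \<forall>x\<in>X. hat v (a + b) x = hat v a x + hat v b x)
       \<and> (\<forall>a b. \<forall>x\<in>X. hat v (a * b) x = hat v a x * hat v b x)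
       \<and> (\<forall>f. continuous_map (spec_top X) (Qp_top v) f \<longrightarrow>
             (\<forall>\<epsilon>>0. \<exists>a. \<forall>x\<in>X. pabs p v (f x - hat v a x) \<le> \<epsilon>))
       \<and> (\<forall>a b. d0 a b \<longrightarrow> (\<forall>x\<in>X. vdvd v (hat v a x) (hat v b x)))"
proof -
  have "0 < p" using assms(1) by (rule prime_gt_0_nat)
  then obtain i :: 'a where "of_nat p * i = 1" using assms(2) by blast
  then interpret R: padic_representation p i d0 v
    using assms by unfold_locales auto
  have hom: "is_ring_hom (\<lambda>a. hat v a x)" if "x \<in> X" for x
    using R.hat_properties(1) that assms(6) by blast
  show ?thesis
  proof (intro conjI allI impI ballI)
    show "continuous_map (spec_top X) (Qp_top v) (hat v a)" for a
      using R.continuous_hat assms(6) by simp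
    show "hat v 1 x = 1" if "x \<in> X" for x
      using hom[OF that] by (simp add: is_ring_hom_def)
    show "hat v (a + b) x = hat v a x + hat v b x" if "x \<in> X" for a b x
      using hom[OF that] by (simp add: is_ring_hom_def)
    show "hat v (a * b) x = hat v a x * hat v b x" if "x \<in> X" for a b x
      using hom[OF that] by (simp add: is_ring_hom_def)
    show "\<exists>a. \<forall>x\<in>X. pabs p v (f x - hat v a x) \<le> \<epsilon>"
      if f: "continuous_map (spec_top X) (Qp_top v) f" and "0 < \<epsilon>" for f and \<epsilon> :: real
    proof -
      obtain N where N: "\<And>y. R.K.Q N y \<Longrightarrow> pabs p v y \<le> \<epsilon>"
        using R.pabs_le[OF \<open>0 < \<epsilon>\<close>] by blast
      obtain a where "\<And>x. x \<in> X \<Longrightarrow> R.K.Q N (f x - hat v a x)"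
        using R.dense_hat f assms(6) by blast
      then show ?thesis using N by blast
    qed
    show "vdvd v (hat v a x) (hat v b x)" if "d0 a b" "x \<in> X" for a b x
      using R.hat_properties(2) R.contains[OF R.Spec_max_Spec] that assms(6) by blast
  qed
qed

end
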